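(* Consider the conformal $p$-values $(p_{i,j})_{(i,j)\in\mathcal D_{\mathrm{test}}}$ described in the context, computed with a scoring function $g$ of the following form: for some $K\in\{1,\dots,n\}$ and some real-valued measurable function $h(\cdot\,;\cdot)$, for every $z=(a,x,\omega)\in\mathcal Z$ and all $1\le i,j\le n$, $$g(z)_{i,j}=h\Big(\big(w(a)_{i,j},x_{N(i,K),\bullet},x_{N(j,K),\bullet}\big)\,;\,\big\{\big(w(a)_{u,v},x_{N(u,K),\bullet},x_{N(v,K),\bullet},a_{u,v}\big)\,:\,\omega_{u,v}=1\big\}\Big).$$ Assume that (a) the score matrix $g(Z_{\mathrm{train}})=(S_{i,j})_{1\le i,j\le n}$ has no ties almost surely; (b) the calibration set size $\ell$ is a function of $k_0=|\mathcal D^0|$ and $\mathcal D^1$ only. For $t\in[0,1]$ let $R(t)=\{(i,j)\in\mathcal D_{\mathrm{test}}:p_{i,j}\le t\}$. Then for any $\delta\in(0,1)$, with probability at least $1-\delta$ with respect to the sampling matrix $\Omega$ and the draw of $\mathcal D_{\mathrm{cal}}$ (i.e. conditionally on $(A^*,X)$, almost surely), it holds that $$\forall t\in[0,1]:\quad \mathrm{FDP}(R(t))\le\frac{m}{1\vee|R(t)|}\,\big(t+\lambda(m,\ell,\delta)\big),$$ where $\lambda(m,\ell,\delta)$ is the $(1-\delta)$-quantile of the universal probability distribution $P_{m,\ell}$ defined in the context, and satisfies $$\lambda(m,\ell,\delta)\le\left(\frac{\log\delta^{-1}+\log\big(1+2\sqrt\pi\,(m\wedge\ell)\big)}{m\w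edge\ell}\right)^{1/2}.$$
   Context: **Model.** $n,d\ge1$ are integers. $A^*=(A^*_{i,j})_{1\le i,j\le n}\in\{0,1\}^{n\times n}$ is a random matrix (adjacency matrix of the true complete graph), $X\in\mathbb R^{n\times d}$ is a random matrix of node covariates, and $\Omega=(\Omega_{i,j})_{1\le i,j\le n}\in\{0,1\}^{n\times n}$ is the sampling matrix ($\Omega_{i,j}=1$ iff the status of $(i,j)$ is observed). The joint law of $(A^*,X)$ is arbitrary; conditionally on $(A^*,X)$, the entries of $\Omega$ are independent with $\Omega_{i,j}\sim\mathrm{Bernoulli}\big(w_0\mathbf 1_{A^*_{i,j}=0}+w_1\mathbf 1_{A^*_{i,j}=1}\big)$ for some unknown $w_0,w_1\in[0,1]$. The observed adjacency matrix is $A_{i,j}=\Omega_{i,j}A^*_{i,j}$, the observation is $Z=(A,X,\Omega)$, $Z^*=(A^*,X,\Omega)$, and $\mathcal Z$ is the observation space. **Sets of pairs.** All are subsets of $\{1,\dots,n\}^2$: $\mathcal D_{\mathrm{test}}=\{(i,j):\Omega_{i,j}=0\}$, $\mathcal D=\{(i,j):\Omega_{i,j}=1\}$, $\mathcal D^0=\{(i,j)\in\mathcal D:A^*_{i,j}=0\}$, $\mathcal D^1=\{(i,j)\in\mathcal D:A^*_{i,j}=1\}$, $\mathcal H_0=\{(i,j):\Omega_{i,j}=0,A^*_{i,j}=0\}$. Set $m=|\mathcal D_{\mathrm{test}}|$. **Scoring function notation.** A scoring function is a measurable $g:\mathcal Z\to\mathbb R^{n\times n}$. For an adjacency matrix $a$,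 $w(a)_{i,j}=(a_{i,\bullet},a_{j,\bullet},a^2_{i,\bullet},a^2_{j,\bullet},\dots,a^K_{i,\bullet},a^K_{j,\bullet})$, where $a^k_{i,\bullet}$ is the $i$-th row of the $k$-th matrix power of $a$; $N(i,K)$ is the $K$-hop neighborhood of node $i$ (in the graph with adjacency matrix $a$); for $S\subset\{1,\dots,n\}$, $x_{S,\bullet}=(x_{u,l})_{u\in S,1\le l\le d}$. **Conformal $p$-values.** Given $Z$, draw $\mathcal D_{\mathrm{cal}}$ of size $\ell\le k_0$ uniformly without replacement from $\mathcal D^0$ (conditionally on $Z^*$). Set $Z_{\mathrm{train}}=(A,X,\Omega_{\mathrm{train}})$, with $(\Omega_{\mathrm{train}})_{i,j}=0$ if $(i,j)\in\mathcal D_{\mathrm{cal}}$ and $(\Omega_{\mathrm{train}})_{i,j}=\Omega_{i,j}$ otherwise. Compute the scores $S_{i,j}=g(Z_{\mathrm{train}})_{i,j}$ and, for $(i,j)\in\mathcal D_{\mathrm{test}}$, $$p_{i,j}=\frac1{\ell+1}\Big(1+\sum_{(u,v)\in\mathcal D_{\mathrm{cal}}}\mathbf 1\{S_{i,j}\le S_{u,v}\}\Big).$$ "No ties" means that the entries $S_{i,j}$, $1\le i,j\le n$, are pairwise distinct. The false discovery proportion is $\mathrm{FDP}(R)=\dfrac{|R\cap\mathcal H_0|}{1\vee|R|}$. **The distribution $P_{m,\ell}$.** Consider a Pólya urn initially containing $\ell+1$ balls of distinct colors $1,\dots,\ell+1$; make $m$ successive draws, each time drawing a ball uniformly at random and returning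 it together with one additional ball of the same color. Let $C_1,\dots,C_m$ be the drawn colors and $\widehat F_m(t)=\frac1m\sum_{i=1}^m\mathbf 1\{C_i/(\ell+1)\le t\}$. Then $P_{m,\ell}$ is the law of $\sup_{t\in[0,1]}(\widehat F_m(t)-t)$. In the statement, $\lambda(m,\ell,\delta)$ is evaluated at the (random) values of $m$ and $\ell$. The upper bound on $\lambda$ is read as $+\infty$ when $m\wedge\ell=0$; when $m=0$ there is nothing to test and the FDP bound is trivial. *)

theory Defs
  imports "HOL-Probability.Probability"
begin

section \<open>Adjacency matrices, sampling matrices and sets of pairs\<close>

text \<open>
  Nodes are the elements of a finite type \<open>'n\<close> (so \<open>n = CARD('n)\<close>) and covariate coordinates the
  elements of a finite type \<open>'d\<close>.  Matrices with entries in \<open>{0,1}\<close> are real matrices satisfying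
  \<open>binary_matrix\<close>; they need not be symmetric, and diagonal entries are not special.
\<close>

definition binary_matrix :: "real^'n^'n \<Rightarrow> bool" where
  "binary_matrix a \<longleftrightarrow> (\<forall>i j. a $ i $ j \<in> {0, 1})"

definition observed_adj :: "real^'n^'n \<Rightarrow> real^'n^'n \<Rightarrow> real^'n^'n" where
  "observed_adj astar \<omega> = (\<chi> i j. \<omega> $ i $ j * astar $ i $ j)"

definition D_test :: "real^'n^'n \<Rightarrow> ('n \<times> 'n) set" where
  "D_test \<omega> = {(i, j). \<omega> $ i $ j = 0}"

definition D_obs :: "real^'n^'n \<Rightarrow> ('n \<times> 'n) set" where
  "D_obs \<omega> = {(i, j). \<omega> $ i $ j = 1}"

definition D0 :: "real^'n^'n \<Rightarrow> real^'n^'n \<Rightarrow> ('n \<times> 'n) set" where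
  "D0 astar \<omega> = {(i, j) \<in> D_obs \<omega>. astar $ i $ j = 0}"

definition D1 :: "real^'n^'n \<Rightarrow> real^'n^'n \<Rightarrow> ('n \<times> 'n) set" where
  "D1 astar \<omega> = {(i, j) \<in> D_obs \<omega>. astar $ i $ j = 1}"

definition H0 :: "real^'n^'n \<Rightarrow> real^'n^'n \<Rightarrow> ('n \<times> 'n) set" where
  "H0 astar \<omega> = {(i, j). \<omega> $ i $ j = 0 \<and> astar $ i $ j = 0}"

definition edge_rate :: "real \<Rightarrow> real \<Rightarrow> real \<Rightarrow> real" where
  "edge_rate w0 w1 b = w0 * of_bool (b = 0) + w1 * of_bool (b = 1)"


section \<open>Observations and scoring functions\<close>

type_synonym ('n, 'd) obs = "(real^'n^'n) \<times> (real^'d^'n) \<times> (real^'n^'n)"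

definition obs_space :: "('n::finite, 'd::finite) obs set" where
  "obs_space = {(a, x, \<omega>). binary_matrix a \<and> binary_matrix \<omega>}"

primrec mat_power :: "real^'n^'n \<Rightarrow> nat \<Rightarrow> real^'n^'n" where
  "mat_power a 0 = mat 1"
| "mat_power a (Suc k) = a ** mat_power a k"

text \<open>
  The tuple \<open>w(a)\<^sub>i\<^sub>j = (a\<^sub>i, a\<^sub>j, a\<^sup>2\<^sub>i, a\<^sup>2\<^sub>j, \<dots>, a\<^sup>K\<^sub>i, a\<^sup>K\<^sub>j)\<close> is grouped as the family, indexed by
  \<open>k \<in> {1..K}\<close>, of the pairs of rows \<open>i\<close> and \<open>j\<close> of the \<open>k\<close>-th power.
\<close>

definition path_rows :: "nat \<Rightarrow> real^'n^'n \<Rightarrow> 'n \<Rightarrow> 'n \<Rightarrow> nat \<Rightarrow> (real^'n) \<times> (real^'n)" where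
  "path_rows K a i j = (\<lambda>k\<in>{1..K}. (mat_power a k $ i, mat_power a k $ j))"

text \<open>Nodes at distance at most \<open>K\<close> from \<open>i\<close> (including \<open>i\<close>), following edges away from \<open>i\<close>.\<close>

definition hop_nbhd :: "real^'n^'n \<Rightarrow> 'n \<Rightarrow> nat \<Rightarrow> 'n set" where
  "hop_nbhd a i K = {u. \<exists>k\<le>K. (i, u) \<in> {(v, v'). a $ v $ v' = 1} ^^ k}"

text \<open>
  The family of covariates with index set \<open>S\<close>.  The size of \<open>S\<close> varies, so the family is encoded
  injectively by its index set together with its extension by zero.
\<close>

definition covariates_on :: "real^'d^'n \<Rightarrow> 'n set \<Rightarrow> 'n set \<times> (real^'d^'n)" where
  "covariates_on x S = (S, \<chi> u l. if u \<in> S then x $ u $ l else 0)"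

type_synonym ('n, 'd) pair_features =
  "(nat \<Rightarrow> (real^'n) \<times> (real^'n)) \<times> ('n set \<times> (real^'d^'n)) \<times> ('n set \<times> (real^'d^'n))"

definition pair_features ::
  "nat \<Rightarrow> real^'n^'n \<Rightarrow> real^'d^'n \<Rightarrow> 'n \<Rightarrow> 'n \<Rightarrow> ('n, 'd) pair_features" where
  "pair_features K a x i j =
     (path_rows K a i j, covariates_on x (hop_nbhd a i K), covariates_on x (hop_nbhd a j K))"

definition feature_space :: "nat \<Rightarrow> ('n::finite, 'd::finite) pair_features measure" where
  "feature_space K =
     (\<Pi>\<^sub>M k\<in>{1..K}. borel) \<Otimes>\<^sub>M
     ((count_space UNIV \<Otimes>\<^sub>M borel) \<Otimes>\<^sub>M (count_space UNIV \<Otimes>\<^sub>M borel))"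

definition training_examples ::
  "nat \<Rightarrow> ('n::finite, 'd::finite) obs \<Rightarrow> (('n, 'd) pair_features \<times> real) set" where
  "training_examples K = (\<lambda>(a, x, \<omega>).
     {(pair_features K a x u v, a $ u $ v) | u v. \<omega> $ u $ v = 1})"

text \<open>
  A function of a point and a finite set is measurable if it is a measurable function of the point
  and of any finite enumeration of the set.
\<close>

definition measurable_with_finite_set ::
  "'y measure \<Rightarrow> 'v measure \<Rightarrow> ('y \<Rightarrow> 'v set \<Rightarrow> real) \<Rightarrow> bool" where
  "measurable_with_finite_set A B h \<longleftrightarrow>
     (\<forall>k::nat. (\<lambda>(y, v). h y (v ` {..<k})) \<in> borel_measurable (A \<Otimes>\<^sub>M (\<Pi>\<^sub>M r\<in>{..<k}. B)))"


section \<open>Conformal p-values\<close>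

definition Omega_train :: "real^'n^'n \<Rightarrow> ('n \<times> 'n) set \<Rightarrow> real^'n^'n" where
  "Omega_train \<omega> C = (\<chi> i j. if (i, j) \<in> C then 0 else \<omega> $ i $ j)"

definition Z_train ::
  "real^'n^'n \<Rightarrow> real^'d^'n \<Rightarrow> real^'n^'n \<Rightarrow> ('n \<times> 'n) set \<Rightarrow> ('n, 'd) obs" where
  "Z_train astar x \<omega> C = (observed_adj astar \<omega>, x, Omega_train \<omega> C)"

definition no_ties :: "real^'n^'n \<Rightarrow> bool" where
  "no_ties s \<longleftrightarrow> inj (\<lambda>(i, j). s $ i $ j)"

definition conf_pvalue :: "nat \<Rightarrow> real^'n^'n \<Rightarrow> ('n \<times> 'n) set \<Rightarrow> 'n \<Rightarrow> 'n \<Rightarrow> real" where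
  "conf_pvalue l s C i j =
     (1 + (\<Sum>(u, v)\<in>C. of_bool (s $ i $ j \<le> s $ u $ v))) / (real l + 1)"

definition rejections ::
  "nat \<Rightarrow> real^'n^'n \<Rightarrow> real^'n^'n \<Rightarrow> ('n \<times> 'n) set \<Rightarrow> real \<Rightarrow> ('n \<times> 'n) set" where
  "rejections l s \<omega> C t = {(i, j) \<in> D_test \<omega>. conf_pvalue l s C i j \<le> t}"

definition FDP :: "('n \<times> 'n) set \<Rightarrow> ('n \<times> 'n) set \<Rightarrow> real" where
  "FDP nulls R = real (card (R \<inter> nulls)) / real (max 1 (card R))"


section \<open>The Polya urn distribution and its quantiles\<close>

text \<open>The colours of the first \<open>m\<close> draws, from an urn with one ball of each colour \<open>1, \<dots>, l + 1\<close>.\<close>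

primrec polya_draws :: "nat \<Rightarrow> nat \<Rightarrow> nat list pmf" where
  "polya_draws l 0 = return_pmf []"
| "polya_draws l (Suc m) =
     bind_pmf (polya_draws l m) (\<lambda>cs.
       map_pmf (\<lambda>c. cs @ [c]) (pmf_of_multiset (mset_set {1..l + 1} + mset cs)))"

definition emp_cdf :: "nat \<Rightarrow> nat list \<Rightarrow> real \<Rightarrow> real" where
  "emp_cdf l cs t =
     (\<Sum>i<length cs. of_bool (real (cs ! i) / (real l + 1) \<le> t)) / real (length cs)"

definition P_polya :: "nat \<Rightarrow> nat \<Rightarrow> real pmf" where
  "P_polya m l = map_pmf (\<lambda>cs. SUP t\<in>{0..1}. emp_cdf l cs t - t) (polya_draws l m)"

definition quantile :: "real measure \<Rightarrow> real \<Rightarrow> real" where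
  "quantile \<mu> q = Inf {x. q \<le> cdf \<mu> x}"

definition lambda_bound :: "nat \<Rightarrow> nat \<Rightarrow> real \<Rightarrow> real" where
  "lambda_bound m l \<delta> = quantile (measure_pmf (P_polya m l)) (1 - \<delta>)"


section \<open>Conditional probabilities given a random variable\<close>

text \<open>
  A version of the conditional probability of the event \<open>E\<close> given the sigma-algebra generated by
  \<open>Y\<close>.  For an event \<open>E\<close> that is not measurable it is the constant \<open>0\<close>, so that a positive lower
  bound on it also asserts measurability of \<open>E\<close>.
\<close>

definition cond_prob_given :: "'w measure \<Rightarrow> ('w \<Rightarrow> 'b::topological_space) \<Rightarrow> 'w set \<Rightarrow> 'w \<Rightarrow> real" where
  "cond_prob_given M Y E = real_cond_exp M (vimage_algebra (space M) Y borel) (indicator E)"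

end

theory Submission
  imports Defs
begin

text \<open>
  Condition on the true adjacency matrix \<open>a\<close> and on the covariates, and further on the sampled edges
  \<open>D1\<close>, on the number of sampled non-edges, and on the union \<open>U\<close> of the unsampled non-edges \<open>H0\<close> and
  the calibration set \<open>C\<close>.  The training observation presents the pairs in \<open>C\<close> as unsampled, so
  it cannot tell the elements of \<open>U\<close> apart, and all scores are fixed.  Non-edges are sampled with equal probability,
  and the size \<open>l\<close> of \<open>C\<close> depends on conditioned quantities only; hence \<open>C\<close> is uniform among the
  \<open>l\<close>-subsets of \<open>U\<close>.  This is lemma \<open>weighted_FDP_control\<close>.

  For fixed distinct scores and a uniform \<open>C\<close>, the numerators of the null p-values are distributed, up
  to order, as the colours drawn from the Polya urn: both the multiset of the numerators and the
  multiset of the drawn colours are uniform among all multisets of the given size over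
  \<open>{1..l + 1}\<close> (lemmas \<open>pmf_mset_polya_draws\<close> and \<open>inj_on_colours\<close>).  The number of nulls is at most the
  number \<open>m\<close> of tests.  Additional draws only increase the number of colours below a given level, so
  that the quantile for \<open>m\<close> draws bounds the number of null p-values that are at most \<open>t\<close> by
  \<open>m * (t + lambda)\<close>, simultaneously in \<open>t\<close> (\<open>card_calibration_sets\<close>).  Division by the number of rejections
  gives the claim.

  For the bound on the quantile, let \<open>N\<close> be the number of draws of a colour at most \<open>j\<close>.  The
  proportion of balls of these colours in the urn is a martingale, whose increment after \<open>k\<close> draws
  ranges over an interval of length \<open>1 / (l + 2 + k)\<close>.  The Azuma-Hoeffding argument gives
  \<open>P(N / m - j / (l + 1) \<ge> x) \<le> exp (- 2 x\<^sup>2 m (l + 1) / (l + 1 + m)) \<le> exp (- s x\<^sup>2)\<close> with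
  \<open>s = min m l\<close>, and a union bound over \<open>s\<close> events costs a factor \<open>s \<le> 1 + 2 sqrt pi s\<close>
  (\<open>polya_sup_tail\<close>).

  The passage from fixed \<open>a\<close> and covariates to conditional probabilities is a finite sum over all
  sampling matrices and calibration sets (\<open>real_cond_exp_finite_mixture\<close>).
\<close>

section \<open>The Polya urn\<close>

lemma urn_nonempty: "mset_set {1..(l :: nat) + 1} + N \<noteq> {#}"
proof -
  have "1 \<in># mset_set {1..l + 1} + N" by simp
  then show ?thesis by (metis empty_not_add_mset multi_member_split)
qed

lemma polya_draws_support:
  assumes "cs \<in> set_pmf (polya_draws l m)"
  shows "length cs = m \<and> set cs \<subseteq> {1..l + 1}"
  using assms
proof (induction m arbitrary: cs)
  case (Suc m)
  then obtain bs c where bs: "bs \<in> set_pmf (polya_draws l m)" "cs = bs @ [c]"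
    and c: "c \<in> set_pmf (pmf_of_multiset (mset_set {1..l + 1} + mset bs))"
    by auto
  have "c \<in># mset_set {1..l + 1} + mset bs"
    using c by (simp only: set_pmf_of_multiset[OF urn_nonempty])
  with Suc.IH[OF bs(1)] bs(2) show ?case by auto
qed simp

lemma finite_polya_draws_support: "finite (set_pmf (polya_draws l m))"
proof (rule finite_subset)
  show "set_pmf (polya_draws l m) \<subseteq> {cs. set cs \<subseteq> {1..l + 1} \<and> length cs = m}"
    using polya_draws_support by blast
qed (simp add: finite_lists_length_eq)

lemma butlast_polya_draws: "map_pmf butlast (polya_draws l (Suc m)) = polya_draws l m"
  by (simp add: map_bind_pmf map_pmf_comp map_pmf_const bind_return_pmf')

lemma pmf_polya_step:
  "pmf (pmf_of_multiset (mset_set {1..l + 1} + N)) c =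
     (of_bool (c \<in> {1..l + 1}) + real (count N c)) / (real l + 1 + real (size N))"
  by (simp only: pmf_of_multiset[OF urn_nonempty]) (auto simp: count_mset_set')

lemma pmf_pair_bind:
  "pmf (bind_pmf p (\<lambda>x. map_pmf (Pair x) (q x))) (a, b) = pmf p a * pmf (q a) b"
proof -
  have "pmf (map_pmf (Pair x) (q x)) (a, b) = indicator {a} x * pmf (q a) b" for x
  proof (cases "x = a")
    case True
    then show ?thesis by (simp add: pmf_map_inj' inj_def)
  next
    case False
    then have "(a, b) \<notin> set_pmf (map_pmf (Pair x) (q x))" by auto
    with False show ?thesis by (simp add: set_pmf_eq)
  qed
  then show ?thesis by (simp add: pmf_bind measure_pmf_single)
qed

text \<open>
  The counts of the colours after \<open>m\<close> draws are uniformly distributed over the multisets of size \<open>m\<close>.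
  Such a multiset \<open>N\<close> arises by drawing last one of its colours \<open>c\<close>, from an urn that then contains
  \<open>count N c\<close> balls of colour \<open>c\<close> among \<open>l + m\<close>; these numbers sum to \<open>m\<close>, whatever \<open>N\<close> is.
\<close>

lemma pmf_mset_polya_draws:
  assumes "N \<in> multisets_of_size {1..l + 1} m"
  shows "pmf (map_pmf mset (polya_draws l m)) N = 1 / real ((l + m) choose m)"
  using assms
proof (induction m arbitrary: N)
  case 0
  then show ?case by (simp add: multisets_of_size_def)
next
  case (Suc m)
  define U where "U = (\<lambda>N. pmf_of_multiset (mset_set {1..l + 1} + N))"
  define J where "J = bind_pmf (map_pmf mset (polya_draws l m)) (\<lambda>N. map_pmf (Pair N) (U N))"
  have N: "size N = Suc m" "set_mset N \<subseteq> {1..l + 1}"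
    using Suc.prems by (auto simp: multisets_of_size_def)
  have step: "map_pmf mset (polya_draws l (Suc m)) = map_pmf (\<lambda>(N, c). add_mset c N) J"
    by (simp add: J_def U_def map_bind_pmf bind_map_pmf map_pmf_comp)
  \<comment> \<open>Disintegrate over the last colour drawn.\<close>
  have vim: "(\<lambda>(N, c). add_mset c N) -` {N} = (\<lambda>c. (N - {#c#}, c)) ` set_mset N"
    by (force simp: image_iff)
  have "pmf (map_pmf mset (polya_draws l (Suc m))) N
      = measure_pmf.prob J ((\<lambda>c. (N - {#c#}, c)) ` set_mset N)"
    unfolding step pmf_map vim ..
  also have "\<dots> = (\<Sum>c\<in>set_mset N. pmf J (N - {#c#}, c))"
    by (subst measure_measure_pmf_finite) (auto intro!: sum.reindex_cong simp: inj_on_def)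
  also have "\<dots> = (\<Sum>c\<in>set_mset N. real (count N c) / ((real l + real m + 1) * real ((l + m) choose m)))"
  proof (rule sum.cong[OF refl])
    fix c assume c: "c \<in># N"
    have "N - {#c#} \<in> multisets_of_size {1..l + 1} m"
      using N c by (auto simp: multisets_of_size_def size_Diff_singleton dest: in_diffD)
    note IH = Suc.IH[OF this]
    have sz: "size (N - {#c#}) = m" using N c by (simp add: size_Diff_singleton)
    have cnt: "real (count (N - {#c#}) c) = real (count N c) - 1"
      using c by (simp add: Suc_leI of_nat_diff)
    have "c \<in> {1..l + 1}" using N c by auto
    then have "pmf (U (N - {#c#})) c = real (count N c) / (real l + real m + 1)"
      unfolding U_def pmf_polya_step sz cnt by (simp add: add_ac)
    then show "pmf J (N - {#c#}, c) = real (count N c) / ((real l + real m + 1) * real ((l + m) choose m))"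
      unfolding J_def pmf_pair_bind IH by simp
  qed
  also have "\<dots> = real (Suc m) / ((real l + real m + 1) * real ((l + m) choose m))"
    unfolding sum_divide_distrib[symmetric] of_nat_sum[symmetric] N(1)[symmetric]
    by (simp add: size_multiset_overloaded_eq)
  also have "\<dots> = 1 / real ((l + Suc m) choose Suc m)"
  proof -
    have "real (Suc m * (Suc (l + m) choose Suc m)) = real (Suc (l + m) * ((l + m) choose m))"
      by (subst Suc_times_binomial_eq) (simp add: mult.commute)
    then have *: "real (Suc m) * real (Suc (l + m) choose Suc m) = (real l + real m + 1) * real ((l + m) choose m)"
      by (simp only: of_nat_mult) (simp add: algebra_simps)
    show ?thesis unfolding *[symmetric] by (simp del: binomial_Suc_Suc of_nat_Suc)
  qed
  finally show ?case .
qed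

text \<open>
  The first \<open>m0\<close> of \<open>m\<close> draws have the law of \<open>m0\<close> draws, so a property that survives the removal
  of draws is at least as likely after fewer draws.
\<close>

lemma polya_draws_antimono:
  assumes "m0 \<le> m" and "\<And>N c. P (add_mset c N) \<Longrightarrow> P N"
  shows "measure_pmf.prob (polya_draws l m) {cs. P (mset cs)}
    \<le> measure_pmf.prob (polya_draws l m0) {cs. P (mset cs)}"
  using assms(1)
proof (induction rule: dec_induct)
  case (step k)
  have "measure_pmf.prob (polya_draws l (Suc k)) {cs. P (mset cs)}
      \<le> measure_pmf.prob (polya_draws l (Suc k)) {cs. P (mset (butlast cs))}"
  proof (rule measure_pmf.finite_measure_mono_AE)
    show "AE cs in measure_pmf (polya_draws l (Suc k)).
        cs \<in> {cs. P (mset cs)} \<longrightarrow> cs \<in> {cs. P (mset (butlast cs))}"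
    proof (rule AE_pmfI)
      fix cs assume "cs \<in> set_pmf (polya_draws l (Suc k))"
      then have "cs \<noteq> []" using polya_draws_support by fastforce
      then have "mset cs = add_mset (last cs) (mset (butlast cs))"
        by (metis append_butlast_last_id mset.simps(2) mset_append union_mset_add_mset_right
            add.right_neutral mset.simps(1))
      then show "cs \<in> {cs. P (mset cs)} \<longrightarrow> cs \<in> {cs. P (mset (butlast cs))}"
        using assms(2) by auto
    qed
  qed simp
  also have "\<dots> = measure_pmf.prob (map_pmf butlast (polya_draws l (Suc k))) {cs. P (mset cs)}"
    by (simp only: measure_map_pmf vimage_def mem_Collect_eq)
  also have "\<dots> = measure_pmf.prob (polya_draws l k) {cs. P (mset cs)}"
    by (simp only: butlast_polya_draws)
  finally show ?case using step.IH by simp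
qed simp


section \<open>Quantiles and empirical distribution functions\<close>

text \<open>
  The infimum that defines the quantile is attained, because distribution functions are continuous
  from the right.
\<close>

lemma
  fixes p :: "real pmf"
  assumes "0 < q" "q < 1"
  shows prob_le_quantile: "q \<le> measure_pmf.prob p {..quantile (measure_pmf p) q}"
    and quantile_le: "q \<le> measure_pmf.prob p {..x} \<Longrightarrow> quantile (measure_pmf p) q \<le> x"
proof -
  define D where "D = distr (measure_pmf p) borel (\<lambda>x. x)"
  interpret D: prob_space D unfolding D_def by (rule measure_pmf.prob_space_distr) simp
  interpret D: real_distribution D by unfold_locales (auto simp: D_def)
  have cdf: "cdf D x = measure_pmf.prob p {..x}" for x
    by (simp add: cdf_def D_def measure_distr)
  define Q where "Q = {x. q \<le> measure_pmf.prob p {..x}}"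
  have quant: "quantile (measure_pmf p) q = Inf Q"
    by (simp add: quantile_def Q_def cdf_def)
  have "\<forall>\<^sub>F x in at_bot. cdf D x < q"
    using D.cdf_lim_at_bot assms(1) by (rule order_tendstoD)
  then obtain b where "\<And>x. x \<le> b \<Longrightarrow> cdf D x < q" by (auto simp: eventually_at_bot_linorder)
  then have bdd: "bdd_below Q"
    by (intro bdd_belowI[of _ b]) (metis (mono_tags, lifting) Q_def cdf linorder_not_le mem_Collect_eq nle_le)
  have "\<forall>\<^sub>F x in at_top. q < cdf D x"
    using D.cdf_lim_at_top_prob assms(2) by (rule order_tendstoD)
  then obtain c where "q < cdf D c" by (auto simp: eventually_at_top_linorder)
  then have ne: "Q \<noteq> {}" by (auto simp: Q_def cdf[symmetric] intro!: exI[of _ c])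
  show "quantile (measure_pmf p) q \<le> x" if "q \<le> measure_pmf.prob p {..x}"
    unfolding quant using that bdd by (intro cInf_lower) (auto simp: Q_def)
  show "q \<le> measure_pmf.prob p {..quantile (measure_pmf p) q}"
  proof -
    have "(cdf D \<longlongrightarrow> cdf D (Inf Q)) (at_right (Inf Q))"
      using D.cdf_is_right_cont by (simp add: continuous_within)
    moreover have "\<forall>\<^sub>F x in at_right (Inf Q). q \<le> cdf D x"
      unfolding eventually_at_right_field
    proof (intro exI[of _ "Inf Q + 1"] conjI allI impI)
      fix y assume "Inf Q < y"
      then obtain z where "z \<in> Q" "z < y" using ne bdd by (meson cInf_less_iff)
      then have "q \<le> cdf D z" "cdf D z \<le> cdf D y"
        by (auto simp: Q_def cdf intro!: measure_pmf.finite_measure_mono)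
      then show "q \<le> cdf D y" by simp
    qed simp
    ultimately have "q \<le> cdf D (Inf Q)"
      by (intro tendsto_lowerbound[of "cdf D"]) auto
    then show ?thesis by (simp add: cdf quant)
  qed
qed

lemma emp_cdf_eq_size:
  "emp_cdf l cs t = real (size {#c \<in># mset cs. real c / (real l + 1) \<le> t#}) / real (length cs)"
proof -
  have "(\<Sum>i<length cs. of_bool (real (cs ! i) / (real l + 1) \<le> t))
      = real (card {i. i < length cs \<and> real (cs ! i) / (real l + 1) \<le> t})"
    by (subst sum_of_bool_eq) (auto intro!: arg_cong[where f = card])
  also have "\<dots> = real (size {#c \<in># mset cs. real c / (real l + 1) \<le> t#})"
    by (subst mset_filter[symmetric], subst size_mset, subst length_filter_conv_card) simp
  finally show ?thesis by (simp add: emp_cdf_def)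
qed

lemma emp_cdf_le_1: "emp_cdf l cs t \<le> 1"
proof -
  have "size {#c \<in># mset cs. real c / (real l + 1) \<le> t#} \<le> length cs"
    by (metis size_filter_mset_lesseq size_mset)
  then show ?thesis unfolding emp_cdf_eq_size by (intro divide_le_eq_1[THEN iffD2]) auto
qed

lemma emp_cdf_diff_le_SUP:
  assumes "t \<in> {0..1}"
  shows "emp_cdf l cs t - t \<le> (SUP t\<in>{0..1}. emp_cdf l cs t - t)"
proof (rule cSUP_upper[OF assms])
  show "bdd_above ((\<lambda>t. emp_cdf l cs t - t) ` {0..1})"
  proof (rule bdd_aboveI2)
    show "emp_cdf l cs t - t \<le> 1" if "t \<in> {0..1}" for t
      using emp_cdf_le_1[of l cs t] that by simp
  qed
qed

text \<open>
  The number of draws in \<open>N\<close> whose normalised colour is at most \<open>t\<close>: the empirical distribution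
  function at \<open>t\<close> before division by the number of draws.
\<close>

definition low_colours :: "nat \<Rightarrow> nat multiset \<Rightarrow> real \<Rightarrow> nat" where
  "low_colours l N t = size {#c \<in># N. real c / (real l + 1) \<le> t#}"

text \<open>
  The quantile of the urn with \<open>m\<close> draws also controls the counts of the urn with fewer draws
  \<open>m0 \<le> m\<close>, as long as the bound itself keeps the factor \<open>m\<close>: the counts increase with the number
  of draws.
\<close>

lemma prob_low_colours:
  assumes "0 < \<delta>" "\<delta> < 1" "m0 \<le> m"
  shows "1 - \<delta> \<le> measure_pmf.prob (polya_draws l m0)
     {cs. \<forall>t\<in>{0..1}. real (low_colours l (mset cs) t) \<le> real m * (t + lambda_bound m l \<delta>)}"
    (is "_ \<le> measure_pmf.prob _ {cs. ?P (mset cs)}")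
proof -
  have "1 - \<delta> \<le> measure_pmf.prob (P_polya m l) {..lambda_bound m l \<delta>}"
    unfolding lambda_bound_def using assms by (intro prob_le_quantile) auto
  also have "\<dots> = measure_pmf.prob (polya_draws l m)
      {cs. (SUP t\<in>{0..1}. emp_cdf l cs t - t) \<le> lambda_bound m l \<delta>}"
    by (simp add: P_polya_def vimage_def)
  also have "\<dots> \<le> measure_pmf.prob (polya_draws l m) {cs. ?P (mset cs)}"
  proof (rule measure_pmf.finite_measure_mono_AE, rule AE_pmfI, safe)
    fix cs and t :: real
    assume cs: "cs \<in> set_pmf (polya_draws l m)" and t: "t \<in> {0..1}"
      and "(SUP t\<in>{0..1}. emp_cdf l cs t - t) \<le> lambda_bound m l \<delta>"
    then have "emp_cdf l cs t - t \<le> lambda_bound m l \<delta>"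
      using emp_cdf_diff_le_SUP[OF t, of l cs] by linarith
    moreover have "length cs = m" using polya_draws_support[OF cs] by simp
    ultimately have "real (low_colours l (mset cs) t) / real m \<le> t + lambda_bound m l \<delta>"
      by (simp add: emp_cdf_eq_size low_colours_def)
    then show "real (low_colours l (mset cs) t) \<le> real m * (t + lambda_bound m l \<delta>)"
      using \<open>length cs = m\<close> by (cases "m = 0") (auto simp: field_simps low_colours_def)
  qed simp
  also have "\<dots> \<le> measure_pmf.prob (polya_draws l m0) {cs. ?P (mset cs)}"
  proof (rule polya_draws_antimono[OF assms(3)])
    fix N c assume P: "?P (add_mset c N)"
    have "low_colours l N t \<le> low_colours l (add_mset c N) t" for t
      by (simp add: low_colours_def)
    then show "?P N" using P by (smt (verit) of_nat_mono)
  qed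
  finally show ?thesis .
qed


section \<open>Uniform calibration sets and the Polya urn\<close>

text \<open>
  The colours of the test points \<open>U - C\<close> for the calibration set \<open>C\<close>: the colour of \<open>i\<close> is the
  numerator of its conformal p-value, namely one plus the number of calibration scores that are at
  least the score of \<open>i\<close>.
\<close>

definition colours :: "('p \<Rightarrow> real) \<Rightarrow> 'p set \<Rightarrow> 'p set \<Rightarrow> nat multiset" where
  "colours f U C = image_mset (\<lambda>i. Suc (card {u \<in> C. f i \<le> f u})) (mset_set (U - C))"

lemma size_filter_colours:
  assumes "finite U"
  shows "size (filter_mset P (colours f U C)) = card {i \<in> U - C. P (Suc (card {u \<in> C. f i \<le> f u}))}"
  using assms by (simp add: colours_def filter_mset_image_mset)

lemma inj_on_rank:
  assumes "finite U" "inj_on f U"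
  shows "inj_on (\<lambda>c. card {u \<in> U. (f c :: real) \<le> f u}) U"
proof -
  have lt: "card {u \<in> U. f d \<le> f u} < card {u \<in> U. f c \<le> f u}" if "c \<in> U" "f c < f d" for c d
  proof (rule psubset_card_mono)
    have "c \<in> {u \<in> U. f c \<le> f u} - {u \<in> U. f d \<le> f u}" using that by simp
    moreover have "{u \<in> U. f d \<le> f u} \<subseteq> {u \<in> U. f c \<le> f u}" using that by auto
    ultimately show "{u \<in> U. f d \<le> f u} \<subset> {u \<in> U. f c \<le> f u}" by blast
  qed (use assms in simp)
  show ?thesis
  proof (rule inj_onI)
    fix c d assume *: "c \<in> U" "d \<in> U" "card {u \<in> U. f c \<le> f u} = card {u \<in> U. f d \<le> f u}"
    then have "f c = f d" using lt[of c d] lt[of d c] by (cases "f c" "f d" rule: linorder_cases) auto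
    then show "c = d" using assms(2) * by (auto dest: inj_onD)
  qed
qed

text \<open>
  The calibration point with the \<open>r\<close>-th largest score in \<open>C\<close> lies below exactly the test points of
  colour at most \<open>r\<close>.  Its rank in \<open>U\<close> is therefore \<open>r\<close> plus the number of these, which depends on
  the multiset of colours only.
\<close>

lemma rank_image_eq:
  assumes U: "finite U" "inj_on f U" and C: "C \<subseteq> U" "card C = l"
  shows "(\<lambda>c. card {u \<in> U. (f c :: real) \<le> f u}) ` C
     = (\<lambda>r. r + size {#k \<in># colours f U C. k \<le> r#}) ` {1..l}"
proof (rule card_seteq)
  have fC: "finite C" using C U finite_subset by blast
  show "(\<lambda>c. card {u \<in> U. f c \<le> f u}) ` C \<subseteq> (\<lambda>r. r + size {#k \<in># colours f U C. k \<le> r#}) ` {1..l}"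
  proof (rule image_subsetI)
    fix c assume c: "c \<in> C"
    define r where "r = card {u \<in> C. f c \<le> f u}"
    have "f c \<le> f i \<longleftrightarrow> Suc (card {u \<in> C. f i \<le> f u}) \<le> r" if i: "i \<in> U - C" for i
    proof
      assume "f c \<le> f i"
      then have "f c < f i" using i c C U(2) by (metis DiffE inj_onD nless_le subsetD)
      then have "c \<in> {u \<in> C. f c \<le> f u} - {u \<in> C. f i \<le> f u}" "{u \<in> C. f i \<le> f u} \<subseteq> {u \<in> C. f c \<le> f u}"
        using c by auto
      then have "{u \<in> C. f i \<le> f u} \<subset> {u \<in> C. f c \<le> f u}" by blast
      then show "Suc (card {u \<in> C. f i \<le> f u}) \<le> r"
        unfolding r_def using fC by (intro Suc_leI psubset_card_mono) auto
    next
      assume *: "Suc (card {u \<in> C. f i \<le> f u}) \<le> r"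
      show "f c \<le> f i"
      proof (rule ccontr)
        assume "\<not> f c \<le> f i"
        then have "r \<le> card {u \<in> C. f i \<le> f u}"
          unfolding r_def using fC by (intro card_mono) auto
        with * show False by simp
      qed
    qed
    then have "{i \<in> U - C. f c \<le> f i} = {i \<in> U - C. Suc (card {u \<in> C. f i \<le> f u}) \<le> r}" by blast
    moreover have "card {u \<in> U. f c \<le> f u} = r + card {i \<in> U - C. f c \<le> f i}"
      unfolding r_def using fC U C by (subst card_Un_disjoint[symmetric]) (auto intro!: arg_cong[where f = card])
    moreover have "r \<le> l" unfolding r_def C(2)[symmetric] using fC by (intro card_mono) auto
    moreover have "r \<noteq> 0" unfolding r_def using fC c by auto
    ultimately show "card {u \<in> U. f c \<le> f u} \<in> (\<lambda>r. r + size {#k \<in># colours f U C. k \<le> r#}) ` {1..l}"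
      using U(1) by (intro image_eqI[of _ _ r]) (auto simp: size_filter_colours)
  qed
  have "card ((\<lambda>r. r + size {#k \<in># colours f U C. k \<le> r#}) ` {1..l}) \<le> l"
    using card_image_le[of "{1..l}"] by simp
  also have "l = card ((\<lambda>c. card {u \<in> U. f c \<le> f u}) ` C)"
    using C inj_on_subset[OF inj_on_rank[OF U] C(1)] by (simp add: card_image)
  finally show "card ((\<lambda>r. r + size {#k \<in># colours f U C. k \<le> r#}) ` {1..l})
      \<le> card ((\<lambda>c. card {u \<in> U. f c \<le> f u}) ` C)" .
qed simp

text \<open>Ranks determine the points, so the multiset of colours determines the calibration set.\<close>

lemma inj_on_colours:
  assumes "finite U" "inj_on f U"
  shows "inj_on (colours f U) {C. C \<subseteq> U \<and> card C = l}"
proof (rule inj_onI)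
  fix C C' assume "C \<in> {C. C \<subseteq> U \<and> card C = l}" "C' \<in> {C. C \<subseteq> U \<and> card C = l}"
    and eq: "colours f U C = colours f U C'"
  then have C: "C \<subseteq> U" "card C = l" "C' \<subseteq> U" "card C' = l" by simp_all
  have "(\<lambda>c. card {u \<in> U. f c \<le> f u}) ` C = (\<lambda>c. card {u \<in> U. f c \<le> f u}) ` C'"
    unfolding rank_image_eq[OF assms C(1,2)] rank_image_eq[OF assms C(3,4)] eq ..
  then show "C = C'"
    using inj_on_image_eq_iff[OF inj_on_rank[OF assms] C(1,3)] by blast
qed

text \<open>
  There are as many \<open>l\<close>-subsets of \<open>U\<close> as multisets of size \<open>card U - l\<close> over \<open>l + 1\<close> colours, so by
  injectivity the colours of a uniform calibration set are distributed as the colours drawn from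
  the urn.  Only the inequality is needed: distinct subsets violating \<open>P\<close> have distinct multisets
  violating \<open>P\<close>.
\<close>

lemma prob_polya_le_card_subsets:
  assumes U: "finite U" "inj_on f U" and l: "l \<le> card U"
  shows "measure_pmf.prob (polya_draws l (card U - l)) {cs. P (mset cs)} * real (card U choose l)
     \<le> real (card {C. C \<subseteq> U \<and> card C = l \<and> P (colours f U C)})"
proof -
  define m where "m = card U - l"
  define MS where "MS = multisets_of_size {1..l + 1} m"
  define p where "p = map_pmf mset (polya_draws l m)"
  define G where "G = {C. C \<subseteq> U \<and> card C = l \<and> P (colours f U C)}"
  define B where "B = {C. C \<subseteq> U \<and> card C = l \<and> \<not> P (colours f U C)}"
  have choose: "real ((l + m) choose m) = real (card U choose l)"
    using binomial_symmetric[of m "l + m"] l by (simp add: m_def)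
  have pos: "real (card U choose l) > 0" using l by simp
  have fin: "finite MS" by (simp add: MS_def finite_multisets_of_size)
  have "card B \<le> card {N \<in> MS. \<not> P N}"
  proof (rule card_inj_on_le)
    show "inj_on (colours f U) B"
      by (rule inj_on_subset[OF inj_on_colours[OF U, of l]]) (auto simp: B_def)
    show "colours f U ` B \<subseteq> {N \<in> MS. \<not> P N}"
    proof clarify
      fix C assume C: "C \<in> B"
      then have "finite C" using U finite_subset by (auto simp: B_def)
      then have "Suc (card {u \<in> C. f i \<le> f u}) \<in> {1..l + 1}" for i
        using C card_mono[of C "{u \<in> C. f i \<le> f u}"] by (auto simp: B_def)
      moreover have "card (U - C) = m"
        using C U by (auto simp: B_def m_def card_Diff_subset finite_subset)
      ultimately show "colours f U C \<in> MS \<and> \<not> P (colours f U C)"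
        using C U by (auto simp: colours_def MS_def multisets_of_size_def B_def)
    qed
  qed (use fin in simp)
  then have "real (card B) \<le> real (card {N \<in> MS. \<not> P N})" by simp
  also have "\<dots> = (\<Sum>N\<in>{N \<in> MS. \<not> P N}. pmf p N) * real (card U choose l)"
    using pos by (simp add: p_def pmf_mset_polya_draws MS_def choose)
  also have "(\<Sum>N\<in>{N \<in> MS. \<not> P N}. pmf p N) = measure_pmf.prob p {N \<in> MS. \<not> P N}"
    using fin by (simp add: measure_measure_pmf_finite)
  also have "\<dots> \<le> measure_pmf.prob p (UNIV - {N. P N})"
    by (intro measure_pmf.finite_measure_mono) auto
  also have "\<dots> = 1 - measure_pmf.prob (polya_draws l m) {cs. P (mset cs)}"
    using measure_pmf.prob_compl[of "{N. P N}" p] by (simp add: p_def vimage_def)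
  finally have "real (card B) \<le> (1 - measure_pmf.prob (polya_draws l m) {cs. P (mset cs)}) * real (card U choose l)"
    using pos by (simp add: mult_right_mono)
  moreover have "real (card U choose l) = real (card G) + real (card B)"
  proof -
    have "card U choose l = card {C. C \<subseteq> U \<and> card C = l}" using U by (simp add: n_subsets)
    also have "{C. C \<subseteq> U \<and> card C = l} = G \<union> B" by (auto simp: G_def B_def)
    also have "card \<dots> = card G + card B"
      using U by (intro card_Un_disjoint) (auto simp: G_def B_def intro: finite_subset[of _ "Pow U"])
    finally show ?thesis by simp
  qed
  ultimately show ?thesis unfolding m_def[symmetric] G_def[symmetric] by (simp add: algebra_simps)
qed

lemma card_calibration_sets:
  fixes f :: "'p \<Rightarrow> real"
  assumes "finite U" "inj_on f U" "l \<le> card U" "card U - l \<le> m" "0 < \<delta>" "\<delta> < 1"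
  shows "(1 - \<delta>) * real (card U choose l) \<le> real (card {C. C \<subseteq> U \<and> card C = l \<and>
     (\<forall>t\<in>{0..1}. real (card {i \<in> U - C. (1 + (\<Sum>u\<in>C. of_bool (f i \<le> f u))) / (real l + 1) \<le> t})
        \<le> real m * (t + lambda_bound m l \<delta>))})"
proof -
  let ?P = "\<lambda>N. \<forall>t\<in>{0..1}. real (low_colours l N t) \<le> real m * (t + lambda_bound m l \<delta>)"
  have "(1 - \<delta>) * real (card U choose l)
      \<le> measure_pmf.prob (polya_draws l (card U - l)) {cs. ?P (mset cs)} * real (card U choose l)"
    using prob_low_colours[OF assms(5,6,4), of l] by (intro mult_right_mono) auto
  also have "\<dots> \<le> real (card {C. C \<subseteq> U \<and> card C = l \<and> ?P (colours f U C)})"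
    by (rule prob_polya_le_card_subsets[OF assms(1-3)])
  also have "{C. C \<subseteq> U \<and> card C = l \<and> ?P (colours f U C)} = {C. C \<subseteq> U \<and> card C = l \<and>
     (\<forall>t\<in>{0..1}. real (card {i \<in> U - C. (1 + (\<Sum>u\<in>C. of_bool (f i \<le> f u))) / (real l + 1) \<le> t})
        \<le> real m * (t + lambda_bound m l \<delta>))}"
  proof (rule Collect_cong, rule conj_cong[OF refl], rule conj_cong[OF refl])
    fix C :: "'p set"
    show "?P (colours f U C) \<longleftrightarrow> (\<forall>t\<in>{0..1}. real (card {i \<in> U - C. (1 + (\<Sum>u\<in>C. of_bool (f i \<le> f u))) / (real l + 1) \<le> t})
        \<le> real m * (t + lambda_bound m l \<delta>))" if "C \<subseteq> U"
    proof -
      have "real (low_colours l (colours f U C) t)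
          = real (card {i \<in> U - C. (1 + (\<Sum>u\<in>C. of_bool (f i \<le> f u))) / (real l + 1) \<le> t})" for t
      proof -
        have "finite C" using that assms(1) finite_subset by blast
        then have "(\<Sum>u\<in>C. of_bool (f i \<le> f u)) = real (card {u \<in> C. f i \<le> f u})" for i
          by (simp add: Int_def)
        then show ?thesis by (simp add: low_colours_def size_filter_colours assms(1))
      qed
      then show ?thesis by presburger
    qed
  qed
  finally show ?thesis .
qed


section \<open>A bound on the quantiles of the Polya urn\<close>

lemma bernoulli_mgf_le:
  fixes p \<eta> :: real
  assumes "0 \<le> p" "0 \<le> \<eta>"
  shows "1 + p * (exp \<eta> - 1) \<le> exp (\<eta> * p + \<eta>\<^sup>2 / 8)"
proof -
  have pos: "1 + p * (exp \<eta> - 1) > 0" using assms by (intro add_pos_nonneg mult_nonneg_nonneg) auto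
  have "ln (1 + p * (exp \<eta> - 1)) \<le> \<eta> * p + \<eta>\<^sup>2 / 8"
    using Hoeffdings_lemma_aux[of \<eta> p] assms by simp
  then have "exp (ln (1 + p * (exp \<eta> - 1))) \<le> exp (\<eta> * p + \<eta>\<^sup>2 / 8)" by (subst exp_le_cancel_iff)
  then show ?thesis using pos by simp
qed

text \<open>The number of draws of a colour at most \<open>j\<close>.\<close>

definition draws_le :: "nat \<Rightarrow> nat list \<Rightarrow> nat" where
  "draws_le j cs = length (filter (\<lambda>c. c \<le> j) cs)"

lemma sum_count_atMost: "(\<Sum>c\<le>j. count N c) = size {#c \<in># N. c \<le> (j :: nat)#}"
proof (induction N)
  case (add x N)
  have "count (add_mset x N) c = count N c + of_bool (c = x)" for c by simp
  then show ?case by (simp only: sum.distrib add.IH) (simp add: of_bool_def)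
qed simp

lemma prob_polya_step_le:
  assumes "j \<le> l + 1"
  shows "measure_pmf.prob (pmf_of_multiset (mset_set {1..l + 1} + mset cs)) {..j}
      = real (j + draws_le j cs) / (real l + 1 + real (length cs))"
proof -
  have "(\<Sum>c\<le>j. of_bool (c \<in> {1..l + 1}) :: real) = real (card ({..j} \<inter> {1..l + 1}))"
    by (simp add: Int_def)
  also have "{..j} \<inter> {1..l + 1} = {1..j}" using assms by auto
  finally have "(\<Sum>c\<le>j. of_bool (c \<in> {1..l + 1}) :: real) = real j" by simp
  moreover have "(\<Sum>c\<le>j. real (count (mset cs) c)) = real (draws_le j cs)"
    unfolding of_nat_sum[symmetric] sum_count_atMost draws_le_def
    by (metis mset_filter size_mset)
  moreover have "pmf (pmf_of_multiset (mset_set {1..l + 1} + mset cs))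
      = (\<lambda>c. (of_bool (c \<in> {1..l + 1}) + real (count (mset cs) c)) / (real l + 1 + real (size (mset cs))))"
    by (rule ext) (rule pmf_polya_step)
  ultimately show ?thesis
    by (simp only: measure_measure_pmf_finite finite_atMost sum_divide_distrib[symmetric]
        sum.distrib size_mset of_nat_add)
qed

text \<open>
  The proportion of balls of colour at most \<open>j\<close> in the urn is a martingale.  Given the past, the
  proportion after \<open>k + 1\<close> draws takes two values at distance \<open>1 / (l + 2 + k)\<close>, so that
  Hoeffding's lemma bounds the moment generating function, with variance proxies dominated by a
  telescoping sum.
\<close>

lemma polya_mgf_le:
  fixes \<theta> :: real
  assumes "0 \<le> \<theta>" "j \<le> l + 1"
  shows "measure_pmf.expectation (polya_draws l m)
           (\<lambda>cs. exp (\<theta> * (real (j + draws_le j cs) / (real l + 1 + real m))))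
    \<le> exp (\<theta> * (real j / (real l + 1)) + \<theta>\<^sup>2 / 8 * (1 / (real l + 1) - 1 / (real l + 1 + real m)))"
proof (induction m)
  case 0
  then show ?case by (simp add: draws_le_def)
next
  case (Suc m)
  define a where "a = real l + 1 + real m"
  have a: "a > 0" by (simp add: a_def)
  define \<eta> where "\<eta> = \<theta> / (a + 1)"
  define E where "E = (\<lambda>cs. exp (\<theta> * (real (j + draws_le j cs) / (a + 1))))"
  define U where "U = (\<lambda>cs. pmf_of_multiset (mset_set {1..l + 1} + mset cs))"
  have step: "measure_pmf.expectation (map_pmf (\<lambda>c. cs @ [c]) (U cs)) E
      \<le> exp (\<theta> * (real (j + draws_le j cs) / a)) * exp (\<eta>\<^sup>2 / 8)"
    if cs: "cs \<in> set_pmf (polya_draws l m)" for cs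
  proof -
    define k where "k = real (j + draws_le j cs)"
    have len: "length cs = m" using polya_draws_support[OF cs] by simp
    have E: "E (cs @ [c]) = exp (\<theta> * (k / (a + 1))) * (1 + (exp \<eta> - 1) * indicator {..j} c)" for c
    proof (cases "c \<le> j")
      case True
      then have "\<theta> * (real (j + draws_le j (cs @ [c])) / (a + 1)) = \<theta> * (k / (a + 1)) + \<eta>"
        by (simp add: draws_le_def k_def \<eta>_def add_divide_distrib distrib_left)
      then show ?thesis using True by (simp add: E_def exp_add)
    qed (simp add: E_def draws_le_def k_def)
    have "measure_pmf.expectation (map_pmf (\<lambda>c. cs @ [c]) (U cs)) E
        = exp (\<theta> * (k / (a + 1))) * (1 + (exp \<eta> - 1) * measure_pmf.prob (U cs) {..j})"
      by (simp add: E measure_pmf.prob_space measure_pmf.emeasure_eq_measure)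
    also have "measure_pmf.prob (U cs) {..j} = k / a"
      unfolding U_def prob_polya_step_le[OF assms(2)] len k_def a_def ..
    also have "1 + (exp \<eta> - 1) * (k / a) \<le> exp (\<eta> * (k / a) + \<eta>\<^sup>2 / 8)"
      using bernoulli_mgf_le[of "k / a" \<eta>] assms(1) a by (simp add: k_def \<eta>_def mult.commute)
    also have "exp (\<theta> * (k / (a + 1))) * exp (\<eta> * (k / a) + \<eta>\<^sup>2 / 8)
        = exp (\<theta> * (k / (a + 1)) + \<eta> * (k / a)) * exp (\<eta>\<^sup>2 / 8)"
      by (simp add: exp_add)
    also have "\<theta> * (k / (a + 1)) + \<eta> * (k / a) = \<theta> * (k / a)"
      using a unfolding \<eta>_def by (simp add: divide_simps) (simp add: algebra_simps)
    finally show ?thesis by (simp add: k_def)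
  qed
  have "measure_pmf.expectation (polya_draws l (Suc m)) E
     = (\<Sum>cs\<in>set_pmf (polya_draws l m). pmf (polya_draws l m) cs *\<^sub>R
          measure_pmf.expectation (map_pmf (\<lambda>c. cs @ [c]) (U cs)) E)"
    unfolding polya_draws.simps U_def
    by (rule pmf_expectation_bind[OF finite_polya_draws_support])
       (simp_all only: set_map_pmf set_pmf_of_multiset[OF urn_nonempty] finite_set_mset finite_imageI order_refl)
  also have "\<dots> \<le> (\<Sum>cs\<in>set_pmf (polya_draws l m). pmf (polya_draws l m) cs *\<^sub>R
      (exp (\<theta> * (real (j + draws_le j cs) / a)) * exp (\<eta>\<^sup>2 / 8)))"
    by (intro sum_mono scaleR_left_mono step) auto
  also have "\<dots> = measure_pmf.expectation (polya_draws l m)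
      (\<lambda>cs. exp (\<theta> * (real (j + draws_le j cs) / a))) * exp (\<eta>\<^sup>2 / 8)"
    by (simp add: integral_measure_pmf[OF finite_polya_draws_support] sum_distrib_left mult_ac)
  also have "\<dots> \<le> exp (\<theta> * (real j / (real l + 1)) + \<theta>\<^sup>2 / 8 * (1 / (real l + 1) - 1 / a)) * exp (\<eta>\<^sup>2 / 8)"
    using Suc.IH unfolding a_def by (intro mult_right_mono) auto
  also have "\<dots> = exp (\<theta> * (real j / (real l + 1)) + \<theta>\<^sup>2 / 8 * (1 / (real l + 1) - 1 / a + 1 / (a + 1)\<^sup>2))"
    unfolding exp_add[symmetric] \<eta>_def power_divide
    by (rule arg_cong[where f = exp]) (simp only: distrib_left times_divide_eq_right mult_1_right divide_divide_eq_left add.assoc mult.commute)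
  also have "\<dots> \<le> exp (\<theta> * (real j / (real l + 1)) + \<theta>\<^sup>2 / 8 * (1 / (real l + 1) - 1 / (a + 1)))"
  proof -
    have "1 / (a + 1)\<^sup>2 \<le> 1 / (a * (a + 1))"
      using a by (intro divide_left_mono) (auto simp: power2_eq_square)
    also have "\<dots> = 1 / a - 1 / (a + 1)" using a by (simp add: field_simps)
    finally have "1 / (real l + 1) - 1 / a + 1 / (a + 1)\<^sup>2 \<le> 1 / (real l + 1) - 1 / (a + 1)" by simp
    then have "\<theta>\<^sup>2 / 8 * (1 / (real l + 1) - 1 / a + 1 / (a + 1)\<^sup>2) \<le> \<theta>\<^sup>2 / 8 * (1 / (real l + 1) - 1 / (a + 1))"
      by (rule mult_left_mono) simp
    then show ?thesis by simp
  qed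
  finally show ?case by (simp add: E_def a_def add_ac)
qed

lemma polya_tail:
  assumes "j \<le> l + 1" "1 \<le> s" "s \<le> m" "s \<le> l" "0 \<le> x"
  shows "measure_pmf.prob (polya_draws l m)
     {cs. real j / (real l + 1) + x \<le> real (draws_le j cs) / real m} \<le> exp (- real s * x\<^sup>2)"
proof -
  define b where "b = real l + 1"
  define n where "n = real m"
  have pos: "b > 0" "n > 0" using assms by (auto simp: b_def n_def)
  \<comment> \<open>This value minimises the exponent obtained from Markov's inequality below.\<close>
  define \<theta> where "\<theta> = 4 * x * b"
  have \<theta>: "\<theta> \<ge> 0" using assms pos by (simp add: \<theta>_def)
  define y where "y = \<theta> * (real j / b + x * n / (b + n))"
  have "measure_pmf.prob (polya_draws l m) {cs. real j / (real l + 1) + x \<le> real (draws_le j cs) / real m}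
      \<le> measure_pmf.prob (polya_draws l m) {cs. exp (\<theta> * (real (j + draws_le j cs) / (b + n))) \<ge> exp y}"
  proof (intro measure_pmf.finite_measure_mono subsetI)
    fix cs assume "cs \<in> {cs. real j / (real l + 1) + x \<le> real (draws_le j cs) / real m}"
    then have "real j / b + x \<le> real (draws_le j cs) / n" by (simp add: b_def n_def)
    then have "n * (real j / b + x) \<le> real (draws_le j cs)" using pos by (simp add: field_simps)
    then have "(real j + n * (real j / b + x)) / (b + n) \<le> real (j + draws_le j cs) / (b + n)"
      using pos by (intro divide_right_mono) auto
    also have "(real j + n * (real j / b + x)) / (b + n) = real j / b + x * n / (b + n)"
      using pos by (simp add: divide_simps) (simp add: algebra_simps)
    finally have "y \<le> \<theta> * (real (j + draws_le j cs) / (b + n))"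
      unfolding y_def using \<theta> by (rule mult_left_mono)
    then show "cs \<in> {cs. exp (\<theta> * (real (j + draws_le j cs) / (b + n))) \<ge> exp y}" by simp
  qed simp
  also have "\<dots> \<le> measure_pmf.expectation (polya_draws l m)
      (\<lambda>cs. exp (\<theta> * (real (j + draws_le j cs) / (b + n)))) / exp y"
    using integral_Markov_inequality_measure[of "measure_pmf (polya_draws l m)"
        "\<lambda>cs. exp (\<theta> * (real (j + draws_le j cs) / (b + n)))" "{}" "exp y"]
    by (simp add: integrable_measure_pmf_finite finite_polya_draws_support del: of_nat_add)
  also have "\<dots> \<le> exp (\<theta> * (real j / b) + \<theta>\<^sup>2 / 8 * (1 / b - 1 / (b + n))) / exp y"
    using polya_mgf_le[OF \<theta> assms(1), of m] by (intro divide_right_mono) (auto simp: b_def n_def add_ac)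
  also have "\<dots> = exp (- (2 * n * b / (b + n)) * x\<^sup>2)"
  proof -
    have "\<theta> * (real j / b) + \<theta>\<^sup>2 / 8 * (1 / b - 1 / (b + n)) - y = - (2 * n * b / (b + n)) * x\<^sup>2"
      using pos unfolding y_def \<theta>_def by (simp add: divide_simps power2_eq_square) (simp add: algebra_simps)
    then show ?thesis by (simp add: exp_diff[symmetric])
  qed
  also have "\<dots> \<le> exp (- real s * x\<^sup>2)"
  proof -
    have "real s * b \<le> n * b" "real s * n \<le> b * n"
      using assms by (intro mult_right_mono; simp add: b_def n_def)+
    then have "real s * (b + n) \<le> 2 * n * b" by (simp add: algebra_simps)
    then have "real s \<le> 2 * n * b / (b + n)" using pos by (simp add: field_simps)
    then have "real s * x\<^sup>2 \<le> (2 * n * b / (b + n)) * x\<^sup>2" by (rule mult_right_mono) simp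
    then show ?thesis by simp
  qed
  finally show ?thesis .
qed

lemma draws_le_mono: "i \<le> j \<Longrightarrow> draws_le i cs \<le> draws_le j cs"
  unfolding draws_le_def by (induction cs) auto

text \<open>
  To bound the supremum over \<open>t\<close> by a nonnegative \<open>x\<close>, it suffices to check the points \<open>j / (l + 1)\<close>
  with \<open>1 \<le> j \<le> l\<close>: the empirical distribution function is constant in between, vanishes at \<open>0\<close> and
  is at most \<open>1\<close> at \<open>1\<close>.
\<close>

lemma emp_cdf_reduce:
  assumes cs: "cs \<in> set_pmf (polya_draws l m)" and t: "t \<in> {0..1}" and x: "0 \<le> x"
    and gt: "x < emp_cdf l cs t - t"
  obtains j where "j \<in> {1..l}" "real j / (real l + 1) + x \<le> real (draws_le j cs) / real m"
proof
  define j where "j = nat \<lfloor>t * (real l + 1)\<rfloor>"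
  have len: "length cs = m" "set cs \<subseteq> {1..l + 1}" using polya_draws_support[OF cs] by auto
  have le: "real c / (real l + 1) \<le> t \<longleftrightarrow> c \<le> j" for c
    using t unfolding j_def by (simp add: le_nat_iff le_floor_iff pos_divide_le_eq)
  have emp: "emp_cdf l cs t = real (draws_le j cs) / real m"
    unfolding emp_cdf_eq_size le len draws_le_def by (metis mset_filter size_mset)
  have "real j / (real l + 1) \<le> t" using le by blast
  then show *: "real j / (real l + 1) + x \<le> real (draws_le j cs) / real m"
    using gt unfolding emp by simp
  have "j \<noteq> 0"
  proof
    assume "j = 0"
    then have "draws_le j cs = 0" using len by (force simp: draws_le_def filter_empty_conv)
    then show False using gt t x by (simp add: emp)
  qed
  moreover have "j \<le> l"
  proof (rule ccontr)
    assume "\<not> j \<le> l"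
    then have "real (l + 1) / (real l + 1) \<le> t" unfolding le by simp
    moreover have "real (l + 1) / (real l + 1) = 1" by (simp add: add.commute)
    ultimately have "t = 1" using t by (metis atLeastAtMost_iff order_antisym)
    then show False using gt x emp_cdf_le_1[of l cs t] by simp
  qed
  ultimately show "j \<in> {1..l}" by simp
qed

text \<open>
  The union bound ranges over the \<open>l\<close> indices \<open>j\<close> if \<open>l \<le> m\<close>.  Otherwise it is taken over the \<open>m\<close>
  positive values \<open>k\<close> of \<open>draws_le j cs\<close>: for each of them the largest \<open>j\<close> for which the count \<open>k\<close> is
  excessive suffices, because \<open>draws_le\<close> is monotone in \<open>j\<close>.
\<close>

lemma polya_sup_tail:
  assumes s: "s = min m l" "1 \<le> s" and x: "0 \<le> x"
  shows "1 - real s * exp (- real s * x\<^sup>2) \<le> measure_pmf.prob (P_polya m l) {..x}"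
proof -
  define B where "B = (\<lambda>j. {cs. real j / (real l + 1) + x \<le> real (draws_le j cs) / real m})"
  have tail: "measure_pmf.prob (polya_draws l m) (B j) \<le> exp (- real s * x\<^sup>2)" if "j \<in> {1..l}" for j
    unfolding B_def using that s x by (intro polya_tail) auto
  have "\<exists>J. finite J \<and> card J \<le> s \<and> J \<subseteq> {1..l} \<and> (\<Union>j\<in>{1..l}. B j \<inter> set_pmf (polya_draws l m)) \<subseteq> (\<Union>j\<in>J. B j)"
  proof (cases "l \<le> m")
    case True
    then show ?thesis using s by (intro exI[of _ "{1..l}"]) auto
  next
    case False
    define A where "A = (\<lambda>k. {j \<in> {1..l}. real j / (real l + 1) + x \<le> real k / real m})"
    define J where "J = (\<lambda>k. Max (A k)) ` {k \<in> {1..m}. A k \<noteq> {}}"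
    have fin: "finite (A k)" for k by (simp add: A_def)
    have "card J \<le> card {k \<in> {1..m}. A k \<noteq> {}}" unfolding J_def by (rule card_image_le) simp
    also have "\<dots> \<le> card {1..m}" by (rule card_mono) auto
    finally have "card J \<le> s" using False s by simp
    moreover have "J \<subseteq> {1..l}"
    proof
      fix j assume "j \<in> J"
      then obtain k where "j = Max (A k)" "A k \<noteq> {}" by (auto simp: J_def)
      then have "j \<in> A k" using Max_in[OF fin] by simp
      then show "j \<in> {1..l}" by (simp add: A_def)
    qed
    moreover have "(\<Union>j\<in>{1..l}. B j \<inter> set_pmf (polya_draws l m)) \<subseteq> (\<Union>j\<in>J. B j)"
    proof clarify
      fix j cs assume j: "j \<in> {1..l}" and cs: "cs \<in> B j" "cs \<in> set_pmf (polya_draws l m)"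
      define k where "k = draws_le j cs"
      have jA: "j \<in> A k" using j cs by (simp add: A_def B_def k_def)
      have "k \<le> m" using polya_draws_support[OF cs(2)] by (auto simp: k_def draws_le_def)
      moreover have "k \<noteq> 0"
      proof
        assume "k = 0"
        then have "real j / (real l + 1) + x \<le> 0" using jA by (simp add: A_def)
        moreover have "real j / (real l + 1) > 0" using j by simp
        ultimately show False using x by linarith
      qed
      ultimately have "Max (A k) \<in> J" using jA by (auto simp: J_def)
      moreover have "cs \<in> B (Max (A k))"
      proof -
        have "j \<le> Max (A k)" using jA fin by simp
        then have "real k \<le> real (draws_le (Max (A k)) cs)" unfolding k_def using draws_le_mono by simp
        then have "real k / real m \<le> real (draws_le (Max (A k)) cs) / real m" by (rule divide_right_mono) simp
        moreover have "Max (A k) \<in> A k" using jA fin by (intro Max_in) auto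
        ultimately show ?thesis by (simp add: A_def B_def)
      qed
      ultimately show "cs \<in> (\<Union>j\<in>J. B j)" by blast
    qed
    ultimately show ?thesis by (intro exI[of _ J]) (simp add: J_def)
  qed
  then obtain J where J: "finite J" "card J \<le> s" "J \<subseteq> {1..l}"
    "(\<Union>j\<in>{1..l}. B j \<inter> set_pmf (polya_draws l m)) \<subseteq> (\<Union>j\<in>J. B j)" by blast
  have "measure_pmf.prob (polya_draws l m) (\<Union>j\<in>J. B j) \<le> (\<Sum>j\<in>J. measure_pmf.prob (polya_draws l m) (B j))"
    by (rule measure_pmf.finite_measure_subadditive_finite) (use J in auto)
  also have "\<dots> \<le> real (card J) * exp (- real s * x\<^sup>2)"
    using J tail by (intro sum_bounded_above) auto
  also have "\<dots> \<le> real s * exp (- real s * x\<^sup>2)"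
    using J by (intro mult_right_mono) auto
  finally have "1 - real s * exp (- real s * x\<^sup>2) \<le> 1 - measure_pmf.prob (polya_draws l m) (\<Union>j\<in>J. B j)"
    by simp
  also have "\<dots> = measure_pmf.prob (polya_draws l m) (UNIV - (\<Union>j\<in>J. B j))"
    using measure_pmf.prob_compl[of "\<Union>j\<in>J. B j" "polya_draws l m"] by simp
  also have "\<dots> \<le> measure_pmf.prob (polya_draws l m) {cs. (SUP t\<in>{0..1}. emp_cdf l cs t - t) \<le> x}"
  proof (rule measure_pmf.finite_measure_mono_AE, rule AE_pmfI, clarify)
    fix cs assume cs: "cs \<in> set_pmf (polya_draws l m)" "cs \<notin> (\<Union>j\<in>J. B j)"
    show "(SUP t\<in>{0..1}. emp_cdf l cs t - t) \<le> x"
    proof (rule cSUP_least)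
      fix t :: real assume t: "t \<in> {0..1}"
      show "emp_cdf l cs t - t \<le> x"
      proof (rule ccontr)
        assume "\<not> emp_cdf l cs t - t \<le> x"
        then obtain j where "j \<in> {1..l}" "cs \<in> B j"
          using emp_cdf_reduce[OF cs(1) t x] unfolding B_def by (metis linorder_not_le mem_Collect_eq)
        then show False using cs J(4) by blast
      qed
    qed simp
  qed simp
  also have "\<dots> = measure_pmf.prob (P_polya m l) {..x}"
    by (simp add: P_polya_def vimage_def)
  finally show ?thesis .
qed

lemma lambda_bound_le:
  assumes "0 < \<delta>" "\<delta> < 1" "1 \<le> min m l"
  shows "lambda_bound m l \<delta> \<le>
     sqrt ((ln (1 / \<delta>) + ln (1 + 2 * sqrt pi * real (min m l))) / real (min m l))"
proof -
  define s where "s = min m l"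
  define c where "c = 1 + 2 * sqrt pi * real s"
  define x where "x = sqrt ((ln (1 / \<delta>) + ln c) / real s)"
  have s: "real s \<ge> 1" using assms(3) by (simp add: s_def)
  have "sqrt pi \<ge> 1" using pi_gt3 by simp
  then have "real s \<le> sqrt pi * real s" using s by (simp add: mult_le_cancel_right1)
  moreover have "c = 1 + 2 * (sqrt pi * real s)" by (simp add: c_def)
  ultimately have c: "real s \<le> c" "1 \<le> c" using s by linarith+
  have nn: "ln (1 / \<delta>) + ln c \<ge> 0" using assms c by (intro add_nonneg_nonneg) auto
  have x: "x \<ge> 0" "real s * x\<^sup>2 = ln (1 / \<delta>) + ln c"
    using nn s by (auto simp: x_def)
  have "real s * exp (- real s * x\<^sup>2) = real s * (\<delta> / c)"
    using assms c x(2) by (simp add: exp_minus exp_add ln_div exp_diff)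
  also have "\<dots> \<le> \<delta>" using assms c s by (simp add: field_simps)
  finally have "1 - \<delta> \<le> 1 - real s * exp (- real s * x\<^sup>2)" by simp
  also have "\<dots> \<le> measure_pmf.prob (P_polya m l) {..x}"
    using s x by (intro polya_sup_tail) (auto simp: s_def)
  finally show ?thesis
    unfolding lambda_bound_def using assms x_def s_def c_def by (intro quantile_le) auto
qed


section \<open>Exchangeability of unsampled and calibration non-edges\<close>

text \<open>The conditional probability that the sampling matrix is \<open>\<omega>\<close>, if the true adjacency matrix is \<open>a\<close>.\<close>

definition sampling_weight :: "real \<Rightarrow> real \<Rightarrow> real^'n^'n \<Rightarrow> real^'n^'n \<Rightarrow> real" where
  "sampling_weight w0 w1 a \<omega> = (\<Prod>i\<in>UNIV. \<Prod>j\<in>UNIV.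
     pmf (bernoulli_pmf (edge_rate w0 w1 (a $ i $ j))) (\<omega> $ i $ j = 1))"

text \<open>The size of the calibration set.\<close>

definition cal_size :: "(nat \<Rightarrow> ('n \<times> 'n) set \<Rightarrow> nat) \<Rightarrow> real^'n^'n \<Rightarrow> real^'n^'n \<Rightarrow> nat" where
  "cal_size ell a \<omega> = ell (card (D0 a \<omega>)) (D1 a \<omega>)"

text \<open>
  The conditional probability that the calibration set is \<open>C\<close>, given \<open>a\<close> and \<open>\<omega>\<close>.  It is zero for all
  \<open>C\<close> if the prescribed size exceeds the number of sampled non-edges.
\<close>

definition cal_weight ::
  "(nat \<Rightarrow> ('n \<times> 'n) set \<Rightarrow> nat) \<Rightarrow> real^'n^'n \<Rightarrow> real^'n^'n \<Rightarrow> ('n \<times> 'n) set \<Rightarrow> real" where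
  "cal_weight ell a \<omega> C =
     of_bool (C \<subseteq> D0 a \<omega> \<and> card C = cal_size ell a \<omega>) / real (card (D0 a \<omega>) choose cal_size ell a \<omega>)"

text \<open>The simultaneous bound on the false discovery proportion, for a realised score matrix \<open>s\<close>.\<close>

definition FDP_controlled ::
  "(nat \<Rightarrow> ('n \<times> 'n) set \<Rightarrow> nat) \<Rightarrow> real \<Rightarrow> real^'n^'n \<Rightarrow> real^'n^'n \<Rightarrow> real^'n^'n \<Rightarrow> ('n \<times> 'n) set \<Rightarrow> bool" where
  "FDP_controlled ell \<delta> a s \<omega> C \<longleftrightarrow> (\<forall>t\<in>{0..1}.
     FDP (H0 a \<omega>) (rejections (cal_size ell a \<omega>) s \<omega> C t)
       \<le> real (card (D_test \<omega>)) / real (max 1 (card (rejections (cal_size ell a \<omega>) s \<omega> C t)))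
          * (t + lambda_bound (card (D_test \<omega>)) (cal_size ell a \<omega>) \<delta>))"

lemma sampling_weight_nonneg: "0 \<le> sampling_weight w0 w1 a \<omega>"
  unfolding sampling_weight_def by (intro prod_nonneg ballI pmf_nonneg)

lemma cal_weight_nonneg: "0 \<le> cal_weight ell a \<omega> C"
  by (simp add: cal_weight_def)

lemma binary_matrixD: "binary_matrix a \<Longrightarrow> a $ i $ j = 0 \<or> a $ i $ j = 1"
  by (auto simp: binary_matrix_def)

lemma finite_binary_matrices: "finite {\<omega> :: real^'n::finite^'n. binary_matrix \<omega>}"
proof (rule finite_imageD)
  show "inj_on D_obs {\<omega> :: real^'n^'n. binary_matrix \<omega>}"
  proof (rule inj_onI)
    fix \<omega> \<omega>' :: "real^'n^'n"
    assume *: "\<omega> \<in> {\<omega>. binary_matrix \<omega>}" "\<omega>' \<in> {\<omega>. binary_matrix \<omega>}" "D_obs \<omega> = D_obs \<omega>'"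
    then have "\<omega> $ i $ j = 1 \<longleftrightarrow> \<omega>' $ i $ j = 1" for i j by (auto simp: D_obs_def set_eq_iff)
    then have "\<omega> $ i $ j = \<omega>' $ i $ j" for i j
      using * binary_matrixD[of \<omega> i j] binary_matrixD[of \<omega>' i j] by (metis mem_Collect_eq)
    then show "\<omega> = \<omega>'" by (simp add: vec_eq_iff)
  qed
qed simp

text \<open>
  Non-edges are sampled with a common probability, so only their number matters for the weight,
  whereas for edges it matters which ones are sampled.
\<close>

lemma sampling_weight_eqI:
  fixes a \<omega> \<omega>' :: "real^'n::finite^'n"
  assumes a: "binary_matrix a"
    and eq: "D1 a \<omega> = D1 a \<omega>'" "card (D0 a \<omega>) = card (D0 a \<omega>')"
  shows "sampling_weight w0 w1 a \<omega> = sampling_weight w0 w1 a \<omega>'"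
proof -
  define N where "N = {(i, j). a $ i $ j = 0}"
  define \<phi> where "\<phi> = (\<lambda>(\<omega> :: real^'n^'n) (i, j). pmf (bernoulli_pmf (edge_rate w0 w1 (a $ i $ j))) (\<omega> $ i $ j = 1))"
  define p where "p = pmf (bernoulli_pmf (edge_rate w0 w1 0))"
  have split: "sampling_weight w0 w1 a \<omega>
      = prod (\<phi> \<omega>) (- N) * (p True ^ card (D0 a \<omega>) * p False ^ (card N - card (D0 a \<omega>)))" for \<omega> :: "real^'n^'n"
  proof -
    have D0: "D0 a \<omega> \<subseteq> N" by (auto simp: D0_def N_def)
    have "sampling_weight w0 w1 a \<omega> = prod (\<phi> \<omega>) UNIV"
      unfolding sampling_weight_def \<phi>_def by (simp add: prod.cartesian_product)
    also have "\<dots> = prod (\<phi> \<omega>) (- N) * prod (\<phi> \<omega>) N"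
      by (subst prod.union_disjoint[symmetric]) auto
    also have "prod (\<phi> \<omega>) N = prod (\<phi> \<omega>) (N - D0 a \<omega>) * prod (\<phi> \<omega>) (D0 a \<omega>)"
      by (rule prod.subset_diff[OF D0]) simp
    also have "prod (\<phi> \<omega>) (D0 a \<omega>) = (\<Prod>_\<in>D0 a \<omega>. p True)"
      by (rule prod.cong) (auto simp: D0_def D_obs_def \<phi>_def p_def)
    also have "prod (\<phi> \<omega>) (N - D0 a \<omega>) = (\<Prod>_\<in>N - D0 a \<omega>. p False)"
    proof (rule prod.cong[OF refl], clarify)
      fix i j assume "(i, j) \<in> N" "(i, j) \<notin> D0 a \<omega>"
      then have "a $ i $ j = 0" "\<omega> $ i $ j \<noteq> 1" by (auto simp: N_def D0_def D_obs_def)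
      then show "\<phi> \<omega> (i, j) = p False" by (simp add: \<phi>_def p_def)
    qed
    finally show ?thesis using D0 by (simp add: card_Diff_subset mult_ac)
  qed
  have "prod (\<phi> \<omega>) (- N) = prod (\<phi> \<omega>') (- N)"
  proof (rule prod.cong[OF refl], clarify)
    fix i j assume "(i, j) \<notin> N"
    then have "a $ i $ j = 1" using binary_matrixD[OF a] by (auto simp: N_def)
    then have "\<omega> $ i $ j = 1 \<longleftrightarrow> \<omega>' $ i $ j = 1"
      using eq(1) by (auto simp: D1_def D_obs_def set_eq_iff)
    then show "\<phi> \<omega> (i, j) = \<phi> \<omega>' (i, j)" by (simp add: \<phi>_def)
  qed
  then show ?thesis unfolding split eq(2) by simp
qed

lemma card_D_test_eqI:
  fixes a \<omega> \<omega>' :: "real^'n::finite^'n"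
  assumes "binary_matrix a" "binary_matrix \<omega>" "binary_matrix \<omega>'"
    and eq: "D1 a \<omega> = D1 a \<omega>'" "card (D0 a \<omega>) = card (D0 a \<omega>')"
  shows "card (D_test \<omega>) = card (D_test \<omega>')"
proof -
  have "card (D_test \<omega>) = card (UNIV :: ('n \<times> 'n) set) - (card (D1 a \<omega>) + card (D0 a \<omega>))"
    if "binary_matrix \<omega>" for \<omega> :: "real^'n^'n"
  proof -
    have "D_test \<omega> = UNIV - (D1 a \<omega> \<union> D0 a \<omega>)"
      using binary_matrixD[OF that] binary_matrixD[OF assms(1)]
      by (fastforce simp: D_test_def D1_def D0_def D_obs_def)
    moreover have "card (D1 a \<omega> \<union> D0 a \<omega>) = card (D1 a \<omega>) + card (D0 a \<omega>)"
      by (rule card_Un_disjoint) (auto simp: D1_def D0_def)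
    ultimately show ?thesis by (simp add: card_Diff_subset)
  qed
  then show ?thesis using assms by simp
qed

lemma H0_Int_D0: "H0 a \<omega> \<inter> D0 a \<omega> = {}"
  by (auto simp: H0_def D0_def D_obs_def)

lemma sampling_matrix_eqI:
  fixes a \<omega> \<omega>' :: "real^'n::finite^'n"
  assumes "binary_matrix a" "binary_matrix \<omega>" "binary_matrix \<omega>'"
    and "D1 a \<omega> = D1 a \<omega>'" "H0 a \<omega> = H0 a \<omega>'"
  shows "\<omega> = \<omega>'"
proof -
  have "\<omega> $ i $ j = \<omega>' $ i $ j" for i j
  proof -
    have "(i, j) \<in> D1 a \<omega> \<longleftrightarrow> (i, j) \<in> D1 a \<omega>'" "(i, j) \<in> H0 a \<omega> \<longleftrightarrow> (i, j) \<in> H0 a \<omega>'"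
      using assms by auto
    then show ?thesis
      using binary_matrixD[OF assms(1), of i j] binary_matrixD[OF assms(2), of i j]
        binary_matrixD[OF assms(3), of i j]
      by (auto simp: D1_def H0_def D_obs_def)
  qed
  then show ?thesis by (simp add: vec_eq_iff)
qed

text \<open>
  Any other subset \<open>C\<close>, of the same size, of the union of unsampled and calibration non-edges is the
  calibration set in another configuration, which has the same sampled edges, the same number of
  sampled non-edges and the same union.
\<close>

lemma exchange_calibration_set:
  fixes a \<omega>0 :: "real^'n::finite^'n"
  assumes bin: "binary_matrix \<omega>0" and C0: "C0 \<subseteq> D0 a \<omega>0"
    and C: "C \<subseteq> H0 a \<omega>0 \<union> C0" "card C = card C0"
  obtains \<omega> where "binary_matrix \<omega>" "D1 a \<omega> = D1 a \<omega>0" "card (D0 a \<omega>) = card (D0 a \<omega>0)"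
    "C \<subseteq> D0 a \<omega>" "H0 a \<omega> \<union> C = H0 a \<omega>0 \<union> C0"
proof
  define U where "U = H0 a \<omega>0 \<union> C0"
  define \<omega> :: "real^'n^'n" where
    "\<omega> = (\<chi> i j. if (i, j) \<in> C then 1 else if (i, j) \<in> U then 0 else \<omega>0 $ i $ j)"
  have CU: "C \<subseteq> U" using C by (simp add: U_def)
  have UN: "a $ i $ j = 0" if "(i, j) \<in> U" for i j
    using that C0 by (auto simp: U_def H0_def D0_def)
  show "binary_matrix \<omega>" using bin by (auto simp: binary_matrix_def \<omega>_def)
  show "D1 a \<omega> = D1 a \<omega>0"
    using UN CU by (fastforce simp: D1_def D_obs_def \<omega>_def split: if_splits)
  have D0: "D0 a \<omega> = C \<union> (D0 a \<omega>0 - C0)"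
  proof (rule set_eqI, clarify)
    fix i j
    have "(i, j) \<in> U \<longleftrightarrow> (i, j) \<in> H0 a \<omega>0 \<or> (i, j) \<in> C0" by (simp add: U_def)
    then show "(i, j) \<in> D0 a \<omega> \<longleftrightarrow> (i, j) \<in> C \<union> (D0 a \<omega>0 - C0)"
      using UN[of i j] CU C0 by (auto simp: D0_def D_obs_def H0_def \<omega>_def)
  qed
  then show "C \<subseteq> D0 a \<omega>" by simp
  have "C \<inter> (D0 a \<omega>0 - C0) = {}" using C H0_Int_D0[of a \<omega>0] by blast
  then have "card (D0 a \<omega>) = card C + (card (D0 a \<omega>0) - card C0)"
    unfolding D0 using C0 by (simp add: card_Un_disjoint card_Diff_subset)
  then show "card (D0 a \<omega>) = card (D0 a \<omega>0)"
    using C(2) card_mono[OF _ C0] by simp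
  have "H0 a \<omega> = U - C"
  proof (rule set_eqI, clarify)
    fix i j
    show "(i, j) \<in> H0 a \<omega> \<longleftrightarrow> (i, j) \<in> U - C"
      using UN[of i j] CU by (auto simp: H0_def \<omega>_def U_def)
  qed
  then show "H0 a \<omega> \<union> C = H0 a \<omega>0 \<union> C0" using CU by (auto simp: U_def)
qed

lemma FDP_controlledI:
  fixes a \<omega> :: "real^'n::finite^'n" and ell :: "nat \<Rightarrow> ('n \<times> 'n) set \<Rightarrow> nat"
  defines "l \<equiv> cal_size ell a \<omega>" and "m \<equiv> card (D_test \<omega>)"
  assumes "\<And>t. t \<in> {0..1} \<Longrightarrow> real (card {(i, j) \<in> H0 a \<omega>. conf_pvalue l s C i j \<le> t})
     \<le> real m * (t + lambda_bound m l \<delta>)"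
  shows "FDP_controlled ell \<delta> a s \<omega> C"
  unfolding FDP_controlled_def l_def[symmetric] m_def[symmetric]
proof
  fix t :: real assume t: "t \<in> {0..1}"
  have "rejections l s \<omega> C t \<inter> H0 a \<omega> = {(i, j) \<in> H0 a \<omega>. conf_pvalue l s C i j \<le> t}"
    by (auto simp: rejections_def H0_def D_test_def)
  then have "real (card (rejections l s \<omega> C t \<inter> H0 a \<omega>)) \<le> real m * (t + lambda_bound m l \<delta>)"
    using assms(3)[OF t] by simp
  then show "FDP (H0 a \<omega>) (rejections l s \<omega> C t)
      \<le> real m / real (max 1 (card (rejections l s \<omega> C t))) * (t + lambda_bound m l \<delta>)"
    unfolding FDP_def times_divide_eq_left by (intro divide_right_mono) auto
qed

text \<open>
  The control of the false discovery proportion for fixed \<open>a\<close> and covariates.  The possible pairs of a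
  sampling matrix and a calibration set are grouped by the key \<open>(D1, |D0|, H0 \<union> C)\<close>.  Within a group
  the weights and the score matrix are constant, and the calibration set ranges over all subsets
  of \<open>H0 \<union> C\<close> of the given size, each of them once.
\<close>

lemma weighted_FDP_control:
  fixes a :: "real^'n::finite^'n" and \<sigma> :: "real^'n^'n \<Rightarrow> ('n \<times> 'n) set \<Rightarrow> real^'n^'n"
    and ell :: "nat \<Rightarrow> ('n \<times> 'n) set \<Rightarrow> nat" and w0 w1 \<delta> :: real
  assumes a: "binary_matrix a" and \<delta>: "0 < \<delta>" "\<delta> < 1"
    and scores: "\<And>\<omega> \<omega>' C C'. \<lbrakk>binary_matrix \<omega>; binary_matrix \<omega>'; C \<subseteq> D0 a \<omega>; C' \<subseteq> D0 a \<omega>';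
       D1 a \<omega> = D1 a \<omega>'; H0 a \<omega> \<union> C = H0 a \<omega>' \<union> C'\<rbrakk> \<Longrightarrow> \<sigma> \<omega> C = \<sigma> \<omega>' C'"
    and ties: "\<And>\<omega> C. \<lbrakk>binary_matrix \<omega>; sampling_weight w0 w1 a \<omega> * cal_weight ell a \<omega> C \<noteq> 0\<rbrakk> \<Longrightarrow> no_ties (\<sigma> \<omega> C)"
  defines "I \<equiv> {\<omega>. binary_matrix \<omega>} \<times> UNIV"
  defines "W \<equiv> \<lambda>(\<omega>, C). sampling_weight w0 w1 a \<omega> * cal_weight ell a \<omega> C"
  shows "(1 - \<delta>) * sum W I \<le> (\<Sum>x\<in>I. W x * of_bool (FDP_controlled ell \<delta> a (\<sigma> (fst x) (snd x)) (fst x) (snd x)))"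
proof -
  define G where "G = (\<lambda>x. FDP_controlled ell \<delta> a (\<sigma> (fst x) (snd x)) (fst x) (snd x))"
  define V where "V = {(\<omega>, C) \<in> I. C \<subseteq> D0 a \<omega> \<and> card C = cal_size ell a \<omega>}"
  define key where "key = (\<lambda>(\<omega>, C). (D1 a \<omega>, card (D0 a \<omega>), H0 a \<omega> \<union> C))"
  have finI: "finite I" unfolding I_def by (intro finite_cartesian_product finite_binary_matrices) simp
  then have finV: "finite V" by (rule finite_subset[rotated]) (auto simp: V_def)
  have W0: "W x = 0" if "x \<in> I - V" for x
    using that by (auto simp: V_def W_def cal_weight_def)
  have VI: "V \<subseteq> I" by (auto simp: V_def)
  have toV: "sum (\<lambda>x. W x * q x) I = sum (\<lambda>x. W x * q x) V" for q
    by (rule sum.mono_neutral_right[OF finI VI]) (auto simp: W0)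
  have W_nonneg: "W x \<ge> 0" for x
    unfolding W_def case_prod_beta by (intro mult_nonneg_nonneg sampling_weight_nonneg cal_weight_nonneg)
  have fibre: "(1 - \<delta>) * sum W {x \<in> V. key x = y} \<le> (\<Sum>x\<in>{x \<in> V. key x = y}. W x * of_bool (G x))"
    if "y \<in> key ` V" for y
  proof -
    from that obtain \<omega>0 C0 where x0: "(\<omega>0, C0) \<in> V" "y = key (\<omega>0, C0)" by auto
    define l where "l = cal_size ell a \<omega>0"
    define m where "m = card (D_test \<omega>0)"
    define U where "U = H0 a \<omega>0 \<union> C0"
    define F where "F = {x \<in> V. key x = y}"
    define c where "c = W (\<omega>0, C0)"
    have bin0: "binary_matrix \<omega>0" and C0: "C0 \<subseteq> D0 a \<omega>0" "card C0 = l"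
      using x0 by (auto simp: V_def I_def l_def)
    have F: "(\<omega>, C) \<in> F \<longleftrightarrow> binary_matrix \<omega> \<and> C \<subseteq> D0 a \<omega> \<and> card C = l \<and>
        D1 a \<omega> = D1 a \<omega>0 \<and> card (D0 a \<omega>) = card (D0 a \<omega>0) \<and> H0 a \<omega> \<union> C = U" for \<omega> C
      by (auto simp: F_def V_def I_def key_def x0(2) U_def l_def cal_size_def)
    have finF: "finite F" using finV by (simp add: F_def)
    have WF: "W x = c" if "x \<in> F" for x
    proof (cases x)
      case (Pair \<omega> C)
      with that have *: "(\<omega>, C) \<in> F" by simp
      then have "cal_size ell a \<omega> = l" by (simp add: F cal_size_def l_def)
      then have "cal_weight ell a \<omega> C = cal_weight ell a \<omega>0 C0"
        using * C0 by (simp add: F cal_weight_def l_def)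
      moreover have "sampling_weight w0 w1 a \<omega> = sampling_weight w0 w1 a \<omega>0"
        using * by (intro sampling_weight_eqI[OF a]) (auto simp: F)
      ultimately show ?thesis by (simp add: W_def c_def Pair)
    qed
    show ?thesis
    proof (cases "c = 0")
      case True
      then show ?thesis using WF by (simp add: F_def[symmetric])
    next
      case False
      define s where "s = \<sigma> \<omega>0 C0"
      define f where "f = (\<lambda>(i, j). s $ i $ j)"
      have "no_ties s" unfolding s_def using ties[OF bin0, of C0] False by (simp add: c_def W_def)
      then have inj: "inj_on f U" unfolding no_ties_def f_def by (rule inj_on_subset) simp
      have sF: "\<sigma> \<omega> C = s" if "(\<omega>, C) \<in> F" for \<omega> C
        unfolding s_def using that bin0 C0 by (intro scores) (auto simp: F U_def)
      have cardU: "card U = card (H0 a \<omega>0) + l"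
        unfolding U_def using H0_Int_D0[of a \<omega>0] C0 by (subst card_Un_disjoint) auto
      have "card (H0 a \<omega>0) \<le> m" unfolding m_def by (rule card_mono) (auto simp: H0_def D_test_def)
      define T where "T = {C. C \<subseteq> U \<and> card C = l \<and>
        (\<forall>t\<in>{0..1}. real (card {i \<in> U - C. (1 + (\<Sum>u\<in>C. of_bool (f i \<le> f u))) / (real l + 1) \<le> t})
            \<le> real m * (t + lambda_bound m l \<delta>))}"
      have "(1 - \<delta>) * real (card U choose l) \<le> real (card T)"
        unfolding T_def using \<open>card (H0 a \<omega>0) \<le> m\<close> cardU
        by (intro card_calibration_sets inj \<delta>) auto
      moreover have "card F \<le> card U choose l"
      proof -
        have "card F = card (snd ` F)"
        proof (rule card_image[symmetric], rule inj_onI)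
          fix x x' assume "x \<in> F" "x' \<in> F" "snd x = snd x'"
          then obtain \<omega> \<omega>' C where x: "x = (\<omega>, C)" "x' = (\<omega>', C)" "(\<omega>, C) \<in> F" "(\<omega>', C) \<in> F"
            by (metis prod.collapse)
          then have "H0 a \<omega> = H0 a \<omega>'"
            using H0_Int_D0[of a \<omega>] H0_Int_D0[of a \<omega>'] unfolding F by blast
          then have "\<omega> = \<omega>'" using x by (intro sampling_matrix_eqI[OF a]) (auto simp: F)
          then show "x = x'" using x by simp
        qed
        also have "\<dots> \<le> card {C. C \<subseteq> U \<and> card C = l}"
          by (rule card_mono) (auto simp: F)
        finally show ?thesis by (simp add: n_subsets)
      qed
      moreover have "card T \<le> card {x \<in> F. G x}"
      proof -
        have "T \<subseteq> snd ` {x \<in> F. G x}"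
        proof
          fix C assume C: "C \<in> T"
          then have CU: "C \<subseteq> H0 a \<omega>0 \<union> C0" "card C = card C0" using C0 by (auto simp: T_def U_def)
          obtain \<omega> where \<omega>: "binary_matrix \<omega>" "D1 a \<omega> = D1 a \<omega>0" "card (D0 a \<omega>) = card (D0 a \<omega>0)"
            "C \<subseteq> D0 a \<omega>" "H0 a \<omega> \<union> C = H0 a \<omega>0 \<union> C0"
            by (rule exchange_calibration_set[OF bin0 C0(1) CU])
          then have xF: "(\<omega>, C) \<in> F" using C by (simp add: F T_def U_def)
          have size: "cal_size ell a \<omega> = l" using \<omega> by (simp add: cal_size_def l_def)
          have test: "card (D_test \<omega>) = m"
            unfolding m_def using \<omega> bin0 by (intro card_D_test_eqI[OF a]) auto
          have H: "H0 a \<omega> = U - C" using \<omega> H0_Int_D0[of a \<omega>] by (auto simp: U_def)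
          have "FDP_controlled ell \<delta> a s \<omega> C"
          proof (rule FDP_controlledI, unfold size test)
            fix t :: real assume t: "t \<in> {0..1}"
            have "{(i, j) \<in> H0 a \<omega>. conf_pvalue l s C i j \<le> t}
               = {i \<in> U - C. (1 + (\<Sum>u\<in>C. of_bool (f i \<le> f u))) / (real l + 1) \<le> t}"
              unfolding H by (auto simp: conf_pvalue_def f_def case_prod_beta)
            then show "real (card {(i, j) \<in> H0 a \<omega>. conf_pvalue l s C i j \<le> t}) \<le> real m * (t + lambda_bound m l \<delta>)"
              using C t by (simp add: T_def)
          qed
          then have "G (\<omega>, C)" by (simp add: G_def sF[OF xF])
          then show "C \<in> snd ` {x \<in> F. G x}" using xF by force
        qed
        then have "card T \<le> card (snd ` {x \<in> F. G x})" using finF by (intro card_mono) auto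
        also have "\<dots> \<le> card {x \<in> F. G x}" using finF by (intro card_image_le) auto
        finally show ?thesis .
      qed
      moreover have "(1 - \<delta>) * real (card F) \<le> (1 - \<delta>) * real (card U choose l)"
        using \<delta> \<open>card F \<le> card U choose l\<close> by (intro mult_left_mono) auto
      ultimately have "(1 - \<delta>) * real (card F) \<le> real (card {x \<in> F. G x})" by linarith
      then have "c * ((1 - \<delta>) * real (card F)) \<le> c * real (card {x \<in> F. G x})"
        using W_nonneg by (intro mult_left_mono) (auto simp: c_def)
      moreover have "sum W F = c * real (card F)" using WF by simp
      moreover have "(\<Sum>x\<in>F. W x * of_bool (G x)) = c * real (card {x \<in> F. G x})"
      proof -
        have "(\<Sum>x\<in>F. W x * of_bool (G x)) = (\<Sum>x\<in>F. c * of_bool (G x))" by (rule sum.cong) (auto simp: WF)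
        also have "\<dots> = c * real (card {x \<in> F. G x})"
          using finF by (simp add: sum_distrib_left[symmetric] Int_def)
        finally show ?thesis .
      qed
      ultimately show ?thesis unfolding F_def[symmetric] by (simp add: mult_ac)
    qed
  qed
  have "(1 - \<delta>) * sum W I = (1 - \<delta>) * sum W V" using toV[of "\<lambda>_. 1"] by simp
  also have "\<dots> = (\<Sum>y\<in>key ` V. (1 - \<delta>) * sum W {x \<in> V. key x = y})"
    by (subst sum.image_gen[OF finV, of _ key]) (simp add: sum_distrib_left)
  also have "\<dots> \<le> (\<Sum>y\<in>key ` V. \<Sum>x\<in>{x \<in> V. key x = y}. W x * of_bool (G x))"
    by (intro sum_mono fibre)
  also have "\<dots> = (\<Sum>x\<in>V. W x * of_bool (G x))" by (rule sum.image_gen[OF finV, symmetric])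
  also have "\<dots> = (\<Sum>x\<in>I. W x * of_bool (G x))" by (rule toV[symmetric])
  finally show ?thesis by (simp add: G_def)
qed


section \<open>Conditional probabilities of events with a finite mixture structure\<close>

text \<open>
  The tower property for \<open>F \<subseteq> G\<close>: the conditional probability of \<open>B\<close> given \<open>G\<close> need agree with an
  \<open>F\<close>-measurable \<open>q\<close> on the \<open>G\<close>-measurable event \<open>A\<close> only.
\<close>

lemma real_cond_exp_indicator_Int:
  assumes "prob_space M" and MG: "subalgebra M G" and GF: "subalgebra G F"
    and A: "A \<in> sets G" and B: "B \<in> sets M"
    and condB: "AE w in M. real_cond_exp M G (indicator B) w = b w"
    and b: "\<And>w. w \<in> A \<Longrightarrow> b w = q w"
    and q: "q \<in> borel_measurable F" "\<And>w. \<bar>q w\<bar> \<le> 1"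
    and condA: "AE w in M. real_cond_exp M F (indicator A) w = c w"
  shows "AE w in M. real_cond_exp M F (indicator (A \<inter> B)) w = c w * (q w :: real)"
proof -
  interpret prob_space M by fact
  interpret G: finite_measure_subalgebra M G by unfold_locales fact
  have MF: "subalgebra M F" using MG GF by (auto simp: subalgebra_def)
  interpret F: finite_measure_subalgebra M F by unfold_locales fact
  have AM: "A \<in> sets M" using A MG by (auto simp: subalgebra_def)
  have qM: "q \<in> borel_measurable M" using measurable_from_subalg[OF MF q(1)] .
  have ind: "indicator (A \<inter> B) = (\<lambda>w. indicator A w * indicator B w :: real)"
    by (auto simp: indicator_def)
  have intAB: "integrable M (indicator (A \<inter> B) :: _ \<Rightarrow> real)"
    using AM B by (intro integrable_const_bound[of _ 1]) auto
  have "AE w in M. real_cond_exp M G (indicator (A \<inter> B)) w = indicator A w * real_cond_exp M G (indicator B) w"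
    unfolding ind using A B intAB by (intro G.real_cond_exp_mult) (auto simp: ind)
  with condB have "AE w in M. real_cond_exp M G (indicator (A \<inter> B)) w = q w * indicator A w"
    by eventually_elim (auto simp: indicator_def b)
  then have "AE w in M. real_cond_exp M F (real_cond_exp M G (indicator (A \<inter> B))) w
      = real_cond_exp M F (\<lambda>w. q w * indicator A w) w"
    by (rule F.real_cond_exp_cong) (use AM qM in \<open>auto intro: borel_measurable_cond_exp2\<close>)
  moreover have "AE w in M. real_cond_exp M F (real_cond_exp M G (indicator (A \<inter> B))) w
      = real_cond_exp M F (indicator (A \<inter> B)) w"
    by (rule F.real_cond_exp_nested_subalg[OF MG GF intAB])
  moreover have "AE w in M. real_cond_exp M F (\<lambda>w. q w * indicator A w) w = q w * real_cond_exp M F (indicator A) w"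
  proof (rule F.real_cond_exp_mult[OF q(1)])
    show "integrable M (\<lambda>w. q w * indicator A w)"
      using AM qM q(2) by (intro integrable_const_bound[of _ 1]) (auto simp: indicator_def)
  qed (use AM in auto)
  ultimately show ?thesis using condA by eventually_elim (simp add: mult.commute)
qed

text \<open>
  If \<open>V i\<close> is the event that a discrete variable has the value \<open>i\<close>, then an event that depends on this
  variable and on \<open>F\<close> has the conditional probability obtained by freezing \<open>F\<close> and averaging over \<open>i\<close>.
\<close>

lemma real_cond_exp_finite_mixture:
  assumes "prob_space M" and MF: "subalgebra M F" and fin: "finite I"
    and V: "\<And>i. i \<in> I \<Longrightarrow> V i \<in> sets M" "disjoint_family_on V I"
    and cond: "\<And>i. i \<in> I \<Longrightarrow> AE w in M. real_cond_exp M F (indicator (V i)) w = c i w"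
    and P: "\<And>i. i \<in> I \<Longrightarrow> P i \<in> sets F"
  shows "AE w in M. real_cond_exp M F (indicator (\<Union>i\<in>I. V i \<inter> P i)) w
    = (\<Sum>i\<in>I. c i w * indicator (P i) w :: real)"
proof -
  interpret prob_space M by fact
  interpret F: finite_measure_subalgebra M F by unfold_locales fact
  have PM: "P i \<in> sets M" if "i \<in> I" for i using P[OF that] MF by (auto simp: subalgebra_def)
  define f where "f = (\<lambda>i w. if i \<in> I then indicator (P i) w * indicator (V i) w else 0 :: real)"
  have int: "integrable M (f i)" for i
    unfolding f_def using V(1) PM
    by (cases "i \<in> I") (auto intro!: integrable_const_bound[of _ 1] simp: indicator_def)
  have ind: "indicator (\<Union>i\<in>I. V i \<inter> P i) = (\<lambda>w. \<Sum>i\<in>I. f i w)"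
  proof
    fix w
    have "disjoint_family_on (\<lambda>i. V i \<inter> P i) I"
      using V(2) by (auto simp: disjoint_family_on_def)
    then have "indicator (\<Union>i\<in>I. V i \<inter> P i) w = (\<Sum>i\<in>I. indicator (V i \<inter> P i) w :: real)"
      by (rule indicator_UN_disjoint[OF fin])
    also have "\<dots> = (\<Sum>i\<in>I. f i w)"
      by (rule sum.cong) (auto simp: f_def indicator_def)
    finally show "indicator (\<Union>i\<in>I. V i \<inter> P i) w = (\<Sum>i\<in>I. f i w)" .
  qed
  have "AE w in M. \<forall>i\<in>I. real_cond_exp M F (f i) w = c i w * indicator (P i) w"
  proof (rule AE_finite_allI[OF fin])
    fix i assume i: "i \<in> I"
    have "AE w in M. real_cond_exp M F (f i) w = indicator (P i) w * real_cond_exp M F (indicator (V i)) w"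
      using F.real_cond_exp_mult[of "indicator (P i)" "indicator (V i)"] P V i int[of i]
      by (simp add: f_def)
    with cond[OF i] show "AE w in M. real_cond_exp M F (f i) w = c i w * indicator (P i) w"
      by eventually_elim (simp add: mult.commute)
  qed
  moreover have "AE w in M. real_cond_exp M F (\<lambda>w. \<Sum>i\<in>I. f i w) w = (\<Sum>i\<in>I. real_cond_exp M F (f i) w)"
    by (rule F.real_cond_exp_sum[OF int])
  ultimately show ?thesis unfolding ind by eventually_elim (simp cong: sum.cong)
qed

lemma subalgebra_vimage_algebra:
  assumes "f \<in> measurable M N"
  shows "subalgebra M (vimage_algebra (space M) f N)"
proof -
  have "f \<in> space M \<rightarrow> space N" using measurable_space[OF assms] by blast
  then show ?thesis
    using measurable_sets[OF assms] by (auto simp: subalgebra_def sets_vimage_algebra2)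
qed


section \<open>Measurability of the scores and of their order\<close>

text \<open>
  The comparisons between all entries of a score matrix.  The p-values and the presence of ties
  depend on the scores through this finite relation only, which gives the measurability of the
  events in question although they quantify over all \<open>t\<close>.
\<close>

definition score_order :: "real^'n^'n \<Rightarrow> (('n \<times> 'n) \<times> 'n \<times> 'n) set" where
  "score_order s = {((i, j), u, v). s $ i $ j \<le> s $ u $ v}"

lemma binary_matrix_measurable:
  fixes Y :: "'w \<Rightarrow> real^'n::finite^'n"
  assumes "Y \<in> borel_measurable F" "\<And>w. w \<in> space F \<Longrightarrow> binary_matrix (Y w)"
  shows "Y \<in> measurable F (count_space {a. binary_matrix a})"
proof -
  have "Y -` {a} \<inter> space F \<in> sets F" for a
    using measurable_sets[OF assms(1), of "{a}"] by simp
  then show ?thesis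
    using assms(2) by (auto simp: measurable_count_space_eq2[OF finite_binary_matrices])
qed

lemma score_order_measurable:
  fixes s :: "'w \<Rightarrow> real^'n::finite^'n"
  assumes "s \<in> borel_measurable F"
  shows "(\<lambda>w. score_order (s w)) \<in> measurable F (count_space UNIV)"
proof -
  have meas: "{w \<in> space F. s w $ i $ j \<le> s w $ u $ v} \<in> sets F" for i j u v
  proof (rule borel_measurable_le)
    have *: "(\<lambda>a :: real^'n^'n. a $ i $ j) \<in> borel_measurable borel" for i j
      by (intro borel_measurable_continuous_onI continuous_intros)
    show "(\<lambda>w. s w $ i $ j) \<in> borel_measurable F" "(\<lambda>w. s w $ u $ v) \<in> borel_measurable F"
      by (rule measurable_compose[OF assms *])+
  qed
  have "(\<lambda>w. score_order (s w)) -` {Q} \<inter> space F \<in> sets F" for Q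
  proof -
    have "(\<lambda>w. score_order (s w)) -` {Q} \<inter> space F
       = {w \<in> space F. \<forall>x\<in>UNIV. case x of ((i, j), u, v) \<Rightarrow> (s w $ i $ j \<le> s w $ u $ v) = (x \<in> Q)}"
      by (auto simp: score_order_def set_eq_iff)
    also have "\<dots> \<in> sets F"
    proof (rule sets.sets_Collect_finite_All')
      fix x :: "('n \<times> 'n) \<times> 'n \<times> 'n"
      obtain i j u v where x: "x = ((i, j), u, v)" by (metis prod.collapse)
      show "{w \<in> space F. case x of ((i, j), u, v) \<Rightarrow> (s w $ i $ j \<le> s w $ u $ v) = (x \<in> Q)} \<in> sets F"
      proof (cases "x \<in> Q")
        case True
        then show ?thesis using meas[of i j u v] by (simp add: x)
      next
        case False
        have "{w \<in> space F. \<not> s w $ i $ j \<le> s w $ u $ v} \<in> sets F"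
          using meas by (rule sets.sets_Collect_neg)
        with False show ?thesis by (simp add: x)
      qed
    qed auto
    finally show ?thesis .
  qed
  then show ?thesis by (subst measurable_count_space_eq2) auto
qed

lemma order_event_measurable:
  fixes Y s :: "'w \<Rightarrow> real^'n::finite^'n"
  assumes "Y \<in> borel_measurable F" "\<And>w. w \<in> space F \<Longrightarrow> binary_matrix (Y w)" "s \<in> borel_measurable F"
    and Q: "\<And>a s s'. score_order s = score_order s' \<Longrightarrow> Q a s \<Longrightarrow> Q a s'"
  shows "{w \<in> space F. Q (Y w) (s w)} \<in> sets F"
proof -
  have "(\<lambda>w. (Y w, score_order (s w))) \<in> measurable F (count_space {a. binary_matrix a} \<Otimes>\<^sub>M count_space UNIV)"
    by (intro measurable_Pair binary_matrix_measurable score_order_measurable assms)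
  then have meas: "(\<lambda>w. (Y w, score_order (s w))) \<in> measurable F (count_space ({a. binary_matrix a} \<times> UNIV))"
    by (simp add: pair_measure_count_space finite_binary_matrices)
  have "{w \<in> space F. Q (Y w) (s w)} = (\<lambda>w. (Y w, score_order (s w))) -`
      ({(a, r). binary_matrix a \<and> (\<exists>s'. score_order s' = r \<and> Q a s')}) \<inter> space F"
  proof (rule set_eqI, rule iffI)
    fix w assume "w \<in> {w \<in> space F. Q (Y w) (s w)}"
    then show "w \<in> (\<lambda>w. (Y w, score_order (s w))) -`
      ({(a, r). binary_matrix a \<and> (\<exists>s'. score_order s' = r \<and> Q a s')}) \<inter> space F"
      using assms(2) by blast
  next
    fix w assume "w \<in> (\<lambda>w. (Y w, score_order (s w))) -`
      ({(a, r). binary_matrix a \<and> (\<exists>s'. score_order s' = r \<and> Q a s')}) \<inter> space F"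
    then obtain s' where "w \<in> space F" "score_order s' = score_order (s w)" "Q (Y w) s'" by blast
    then show "w \<in> {w \<in> space F. Q (Y w) (s w)}" using Q by blast
  qed
  also have "\<dots> \<in> sets F" by (rule measurable_sets[OF meas]) auto
  finally show ?thesis .
qed

lemma rejections_cong:
  assumes "score_order s = score_order s'"
  shows "rejections l s \<omega> C t = rejections l s' \<omega> C t"
proof -
  have "s $ i $ j \<le> s $ u $ v \<longleftrightarrow> s' $ i $ j \<le> s' $ u $ v" for i j u v
    using assms by (auto simp: score_order_def set_eq_iff)
  then show ?thesis by (simp add: rejections_def conf_pvalue_def)
qed

lemma no_ties_cong:
  assumes "score_order s = score_order s'"
  shows "no_ties s \<longleftrightarrow> no_ties s'"
proof -
  have "s $ i $ j \<le> s $ u $ v \<longleftrightarrow> s' $ i $ j \<le> s' $ u $ v" for i j u v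
    using assms by (auto simp: score_order_def set_eq_iff)
  then have "s $ i $ j = s $ u $ v \<longleftrightarrow> s' $ i $ j = s' $ u $ v" for i j u v
    by (metis order_antisym order_refl)
  then show ?thesis by (simp add: no_ties_def inj_on_def)
qed

lemma Z_train_in_obs_space:
  assumes a: "binary_matrix a" and \<omega>: "binary_matrix \<omega>"
  shows "Z_train a x \<omega> C \<in> obs_space"
proof -
  have "\<omega> $ i $ j * a $ i $ j \<in> {0, 1}" for i j
    using binary_matrixD[OF a, of i j] binary_matrixD[OF \<omega>, of i j] by auto
  then have "binary_matrix (observed_adj a \<omega>)" by (simp add: observed_adj_def binary_matrix_def)
  moreover have "binary_matrix (Omega_train \<omega> C)"
    using \<omega> by (simp add: Omega_train_def binary_matrix_def)
  ultimately show ?thesis by (simp add: Z_train_def obs_space_def)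
qed

lemma score_measurable:
  fixes g :: "('n::finite, 'd::finite) obs \<Rightarrow> real^'n^'n"
  assumes g: "g \<in> borel_measurable (restrict_space borel obs_space)"
    and Y: "Y \<in> borel_measurable F" "\<And>w. w \<in> space F \<Longrightarrow> binary_matrix (Y w)"
    and X: "X \<in> borel_measurable F" and \<omega>: "binary_matrix \<omega>"
  shows "(\<lambda>w. g (Z_train (Y w) (X w) \<omega> C)) \<in> borel_measurable F"
proof -
  have "continuous_on UNIV (\<lambda>a :: real^'n^'n. observed_adj a \<omega>)"
    unfolding observed_adj_def by (intro continuous_intros)
  then have "(\<lambda>a :: real^'n^'n. observed_adj a \<omega>) \<in> borel_measurable borel"
    by (rule borel_measurable_continuous_onI)
  from measurable_compose[OF Y(1) this] have "(\<lambda>w. Z_train (Y w) (X w) \<omega> C) \<in> borel_measurable F"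
    unfolding Z_train_def by (intro borel_measurable_Pair X borel_measurable_const)
  then have "(\<lambda>w. Z_train (Y w) (X w) \<omega> C) \<in> measurable F (restrict_space borel obs_space)"
    using Z_train_in_obs_space[OF Y(2) \<omega>] by (intro measurable_restrict_space2) auto
  from measurable_compose[OF this g] show ?thesis .
qed

text \<open>
  The training observation does not reveal which of the non-edges in \<open>H0 \<union> C\<close> are calibration points:
  it is determined by the sampled edges and by this union.
\<close>

lemma Z_train_cong:
  fixes a \<omega> \<omega>' :: "real^'n::finite^'n"
  assumes bin: "binary_matrix a" "binary_matrix \<omega>" "binary_matrix \<omega>'"
    and C: "C \<subseteq> D0 a \<omega>" "C' \<subseteq> D0 a \<omega>'"
    and eq: "D1 a \<omega> = D1 a \<omega>'" "H0 a \<omega> \<union> C = H0 a \<omega>' \<union> C'"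
  shows "Z_train a x \<omega> C = Z_train a x \<omega>' C'"
proof -
  have "observed_adj a \<omega> $ i $ j = observed_adj a \<omega>' $ i $ j
      \<and> Omega_train \<omega> C $ i $ j = Omega_train \<omega>' C' $ i $ j" for i j
  proof -
    have *: "(i, j) \<in> D1 a \<omega> \<longleftrightarrow> (i, j) \<in> D1 a \<omega>'"
      "(i, j) \<in> H0 a \<omega> \<or> (i, j) \<in> C \<longleftrightarrow> (i, j) \<in> H0 a \<omega>' \<or> (i, j) \<in> C'"
      "(i, j) \<in> C \<Longrightarrow> (i, j) \<in> D0 a \<omega>" "(i, j) \<in> C' \<Longrightarrow> (i, j) \<in> D0 a \<omega>'"
      using eq C by blast+
    from binary_matrixD[OF bin(1), of i j] show ?thesis
    proof
      assume a0: "a $ i $ j = 0"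
      have "\<omega> $ i $ j = 0 \<or> (i, j) \<in> C \<longleftrightarrow> \<omega>' $ i $ j = 0 \<or> (i, j) \<in> C'"
        using *(2) a0 by (simp add: H0_def)
      then show ?thesis
        using a0 binary_matrixD[OF bin(2), of i j] binary_matrixD[OF bin(3), of i j]
        by (auto simp: observed_adj_def Omega_train_def)
    next
      assume a1: "a $ i $ j = 1"
      then have "(i, j) \<notin> C" "(i, j) \<notin> C'" using *(3,4) by (auto simp: D0_def)
      moreover have "\<omega> $ i $ j = \<omega>' $ i $ j"
        using *(1) a1 binary_matrixD[OF bin(2), of i j] binary_matrixD[OF bin(3), of i j]
        by (auto simp: D1_def D_obs_def)
      ultimately show ?thesis by (simp add: observed_adj_def Omega_train_def)
    qed
  qed
  then show ?thesis by (simp add: Z_train_def vec_eq_iff)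
qed

lemma FDP_controlled_cong:
  assumes "score_order s = score_order s'" "FDP_controlled ell \<delta> a s \<omega> C"
  shows "FDP_controlled ell \<delta> a s' \<omega> C"
  using assms(2) unfolding FDP_controlled_def rejections_cong[OF assms(1)] .


section \<open>Conditional control of the false discovery proportion\<close>

lemma pmf_of_cal_set:
  fixes a \<omega> :: "real^'n::finite^'n"
  assumes "cal_size ell a \<omega> \<le> card (D0 a \<omega>)"
  shows "pmf (pmf_of_set {B. B \<subseteq> D0 a \<omega> \<and> card B = cal_size ell a \<omega>}) C = cal_weight ell a \<omega> C"
proof -
  let ?A = "{B. B \<subseteq> D0 a \<omega> \<and> card B = cal_size ell a \<omega>}"
  have card: "card ?A = card (D0 a \<omega>) choose cal_size ell a \<omega>" by (simp add: n_subsets)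
  then have "card ?A \<noteq> 0" using assms by simp
  then have "?A \<noteq> {}" by (metis card.empty)
  then show ?thesis by (simp add: pmf_of_set card cal_weight_def indicator_def)
qed

theorem theorem4:
  fixes M :: "'w measure"
    and Astar Omega :: "'w \<Rightarrow> real^'n::finite^'n"
    and X :: "'w \<Rightarrow> real^'d::finite^'n"
    and Dcal :: "'w \<Rightarrow> ('n \<times> 'n) set"
    and ell :: "nat \<Rightarrow> ('n \<times> 'n) set \<Rightarrow> nat"
    and g :: "('n, 'd) obs \<Rightarrow> real^'n^'n"
    and h :: "('n, 'd) pair_features \<Rightarrow> (('n, 'd) pair_features \<times> real) set \<Rightarrow> real"
    and K :: nat and w0 w1 \<delta> :: real
  defines "k0 \<equiv> \<lambda>w. card (D0 (Astar w) (Omega w))"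
  defines "L \<equiv> \<lambda>w. ell (k0 w) (D1 (Astar w) (Omega w))"
  defines "S \<equiv> \<lambda>w. g (Z_train (Astar w) (X w) (Omega w) (Dcal w))"
  defines "R \<equiv> \<lambda>w. rejections (L w) (S w) (Omega w) (Dcal w)"
  defines "m \<equiv> \<lambda>w. card (D_test (Omega w))"
  assumes "prob_space M"
    and "Astar \<in> borel_measurable M" and "X \<in> borel_measurable M"
    and "Omega \<in> borel_measurable M" and "Dcal \<in> measurable M (count_space UNIV)"
    and "\<And>w. w \<in> space M \<Longrightarrow> binary_matrix (Astar w)"
    and "\<And>w. w \<in> space M \<Longrightarrow> binary_matrix (Omega w)"
    and "w0 \<in> {0..1}" and "w1 \<in> {0..1}"
    and Omega_law: "\<And>\<omega>. binary_matrix \<omega> \<Longrightarrow>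
      AE w in M. cond_prob_given M (\<lambda>w. (Astar w, X w)) {w' \<in> space M. Omega w' = \<omega>} w =
        (\<Prod>i\<in>UNIV. \<Prod>j\<in>UNIV.
           pmf (bernoulli_pmf (edge_rate w0 w1 (Astar w $ i $ j))) (\<omega> $ i $ j = 1))"
    and ell_le: "\<And>w. w \<in> space M \<Longrightarrow> L w \<le> k0 w"
    and Dcal_law: "\<And>C.
      AE w in M. cond_prob_given M (\<lambda>w. (Astar w, X w, Omega w)) {w' \<in> space M. Dcal w' = C} w =
        pmf (pmf_of_set {B. B \<subseteq> D0 (Astar w) (Omega w) \<and> card B = L w}) C"
    and g_measurable: "g \<in> borel_measurable (restrict_space borel obs_space)"
    and "K \<in> {1..CARD('n)}"
    and h_measurable:
      "measurable_with_finite_set (feature_space K) (feature_space K \<Otimes>\<^sub>M borel) h"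
    and g_form: "\<And>a x \<omega> i j. (a, x, \<omega>) \<in> obs_space \<Longrightarrow>
      g (a, x, \<omega>) $ i $ j = h (pair_features K a x i j) (training_examples K (a, x, \<omega>))"
    and "AE w in M. no_ties (S w)"
    and "0 < \<delta>" and "\<delta> < 1"
  shows "(AE w in M.
      1 - \<delta> \<le> cond_prob_given M (\<lambda>w. (Astar w, X w))
        {w' \<in> space M. \<forall>t\<in>{0..1}.
           FDP (H0 (Astar w') (Omega w')) (R w' t)
             \<le> real (m w') / real (max 1 (card (R w' t))) * (t + lambda_bound (m w') (L w') \<delta>)} w) \<and>
    (\<forall>m' l. 1 \<le> min m' l \<longrightarrow>
       lambda_bound m' l \<delta> \<le>
         sqrt ((ln (1 / \<delta>) + ln (1 + 2 * sqrt pi * real (min m' l))) / real (min m' l)))"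
proof (intro conjI allI impI)
  fix m' l :: nat assume "1 \<le> min m' l"
  then show "lambda_bound m' l \<delta> \<le>
      sqrt ((ln (1 / \<delta>) + ln (1 + 2 * sqrt pi * real (min m' l))) / real (min m' l))"
    by (intro lambda_bound_le \<open>0 < \<delta>\<close> \<open>\<delta> < 1\<close>)
next
  interpret prob_space M by fact
  note meas [measurable] = \<open>Astar \<in> borel_measurable M\<close> \<open>X \<in> borel_measurable M\<close>
    \<open>Omega \<in> borel_measurable M\<close> \<open>Dcal \<in> measurable M (count_space UNIV)\<close>
  note bin = \<open>\<And>w. w \<in> space M \<Longrightarrow> binary_matrix (Astar w)\<close> \<open>\<And>w. w \<in> space M \<Longrightarrow> binary_matrix (Omega w)\<close>
  \<comment> \<open>The sigma-algebras generated by \<open>(A*, X)\<close> and by \<open>(A*, X, Omega)\<close>.\<close>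
  define F where "F = vimage_algebra (space M) (\<lambda>w. (Astar w, X w)) borel"
  define G where "G = vimage_algebra (space M) (\<lambda>w. (Astar w, X w, Omega w)) borel"
  have spF: "space F = space M" and spG: "space G = space M" by (simp_all add: F_def G_def)
  have "(\<lambda>w. (Astar w, X w)) \<in> measurable F borel"
    unfolding F_def by (rule measurable_vimage_algebra1) simp
  from measurable_compose[OF this borel_measurable_continuous_onI[OF continuous_on_fst[OF continuous_on_id]]]
    measurable_compose[OF this borel_measurable_continuous_onI[OF continuous_on_snd[OF continuous_on_id]]]
  have AF: "Astar \<in> borel_measurable F" and XF: "X \<in> borel_measurable F" by simp_all
  have GG: "(\<lambda>w. (Astar w, X w, Omega w)) \<in> measurable G borel"
    unfolding G_def by (rule measurable_vimage_algebra1) simp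
  have "continuous_on UNIV (\<lambda>z :: (real^'n^'n) \<times> (real^'d^'n) \<times> (real^'n^'n). (fst z, fst (snd z)))"
    by (intro continuous_intros)
  from measurable_compose[OF GG borel_measurable_continuous_onI[OF this]]
  have AXG: "(\<lambda>w. (Astar w, X w)) \<in> borel_measurable G" by simp
  have "continuous_on UNIV (\<lambda>z :: (real^'n^'n) \<times> (real^'d^'n) \<times> (real^'n^'n). snd (snd z))"
    by (intro continuous_intros)
  from measurable_compose[OF GG borel_measurable_continuous_onI[OF this]]
  have OG: "Omega \<in> borel_measurable G" by simp
  have MG: "subalgebra M G" unfolding G_def
    by (rule subalgebra_vimage_algebra) (intro borel_measurable_Pair meas)
  have MF: "subalgebra M F" unfolding F_def
    by (rule subalgebra_vimage_algebra) (intro borel_measurable_Pair meas)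
  have GF: "subalgebra G F"
    using subalgebra_vimage_algebra[OF AXG] by (simp add: F_def spG)
  have binF: "\<And>w. w \<in> space F \<Longrightarrow> binary_matrix (Astar w)" using bin spF by simp

  define I where "I = {\<omega> :: real^'n^'n. binary_matrix \<omega>} \<times> (UNIV :: ('n \<times> 'n) set set)"
  define V where "V = (\<lambda>(\<omega>, C). {w \<in> space M. Omega w = \<omega>} \<inter> {w \<in> space M. Dcal w = C})"
  define W where "W = (\<lambda>a (\<omega>, C). sampling_weight w0 w1 a \<omega> * cal_weight ell a \<omega> C)"
  define \<sigma> where "\<sigma> = (\<lambda>w \<omega> C. g (Z_train (Astar w) (X w) \<omega> C))"
  have finI: "finite I" unfolding I_def by (intro finite_cartesian_product finite_binary_matrices) simp
  have OmM: "{w \<in> space M. Omega w = \<omega>} \<in> sets M" for \<omega> by measurable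
  have DcM: "{w \<in> space M. Dcal w = C} \<in> sets M" for C by measurable
  have VM: "V i \<in> sets M" for i unfolding V_def case_prod_beta using OmM DcM by (intro sets.Int)
  have disj: "disjoint_family_on V I" by (auto simp: disjoint_family_on_def V_def)
  have ell: "cal_size ell (Astar w) (Omega w) \<le> card (D0 (Astar w) (Omega w))" if "w \<in> space M" for w
    using ell_le[OF that] by (simp add: L_def k0_def cal_size_def)
  have cond: "AE w in M. real_cond_exp M F (indicator (V i)) w = W (Astar w) i" if i: "i \<in> I" for i
  proof -
    obtain \<omega> C where ic: "i = (\<omega>, C)" and \<omega>: "binary_matrix \<omega>" using i by (auto simp: I_def)
    define q where "q = (\<lambda>w. if w \<in> space M then cal_weight ell (Astar w) \<omega> C else 0)"
    have le1: "\<bar>cal_weight ell a \<omega> C\<bar> \<le> 1" for a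
      using not_less_eq_eq by (auto simp: cal_weight_def divide_le_eq_1 Suc_le_eq)
    have "AE w in M. real_cond_exp M F (indicator ({w \<in> space M. Omega w = \<omega>} \<inter> {w \<in> space M. Dcal w = C})) w
        = sampling_weight w0 w1 (Astar w) \<omega> * q w"
    proof (rule real_cond_exp_indicator_Int[OF \<open>prob_space M\<close> MG GF _ DcM])
      have "Omega -` {\<omega>} \<inter> space G \<in> sets G" by (rule measurable_sets[OF OG]) simp
      moreover have "Omega -` {\<omega>} \<inter> space G = {w \<in> space M. Omega w = \<omega>}" by (auto simp: spG)
      ultimately show "{w \<in> space M. Omega w = \<omega>} \<in> sets G" by simp
      show "AE w in M. real_cond_exp M G (indicator {w \<in> space M. Dcal w = C}) w =
          pmf (pmf_of_set {B. B \<subseteq> D0 (Astar w) (Omega w) \<and> card B = L w}) C"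
        using Dcal_law[of C] unfolding cond_prob_given_def G_def .
      show "pmf (pmf_of_set {B. B \<subseteq> D0 (Astar w) (Omega w) \<and> card B = L w}) C = q w"
        if "w \<in> {w \<in> space M. Omega w = \<omega>}" for w
      proof -
        have "L w = cal_size ell (Astar w) (Omega w)" by (simp add: L_def k0_def cal_size_def)
        then show ?thesis using that ell[of w] pmf_of_cal_set[of ell "Astar w" "Omega w" C] by (auto simp: q_def)
      qed
      have "(\<lambda>w. cal_weight ell (Astar w) \<omega> C) \<in> borel_measurable F"
        by (rule measurable_compose[OF binary_matrix_measurable[OF AF binF]])
          simp_all
      then show "q \<in> borel_measurable F" by (rule measurable_cong[THEN iffD1, rotated]) (simp add: q_def spF)
      show "\<bar>q w\<bar> \<le> 1" for w using le1 by (simp add: q_def)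
      show "AE w in M. real_cond_exp M F (indicator {w \<in> space M. Omega w = \<omega>}) w = sampling_weight w0 w1 (Astar w) \<omega>"
        using Omega_law[OF \<omega>] unfolding cond_prob_given_def F_def sampling_weight_def .
    qed
    with AE_space show ?thesis by eventually_elim (simp add: V_def W_def ic q_def)
  qed
  \<comment> \<open>The conditional probability given \<open>(A*, X)\<close> of an event that sees the scores through their order
    only is a finite sum over the sampling matrices and calibration sets.\<close>
  have mixture: "AE w in M. real_cond_exp M F (indicator {w \<in> space M. Q (Astar w) (\<sigma> w (Omega w) (Dcal w)) (Omega w) (Dcal w)}) w
      = (\<Sum>i\<in>I. W (Astar w) i * of_bool (Q (Astar w) (\<sigma> w (fst i) (snd i)) (fst i) (snd i)))"
    and event: "{w \<in> space M. Q (Astar w) (\<sigma> w (Omega w) (Dcal w)) (Omega w) (Dcal w)} \<in> sets M"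
    if Q: "\<And>a s s' \<omega> C. score_order s = score_order s' \<Longrightarrow> Q a s \<omega> C \<Longrightarrow> Q a s' \<omega> C" for Q
  proof -
    define P where "P = (\<lambda>i. {w \<in> space F. Q (Astar w) (\<sigma> w (fst i) (snd i)) (fst i) (snd i)})"
    have PF: "P i \<in> sets F" if "i \<in> I" for i
      unfolding P_def
    proof (rule order_event_measurable[OF AF binF])
      show "(\<lambda>w. \<sigma> w (fst i) (snd i)) \<in> borel_measurable F"
        unfolding \<sigma>_def using that by (intro score_measurable[OF g_measurable AF binF XF]) (auto simp: I_def)
    qed (use Q in \<open>blast+\<close>)
    have eq: "{w \<in> space M. Q (Astar w) (\<sigma> w (Omega w) (Dcal w)) (Omega w) (Dcal w)} = (\<Union>i\<in>I. V i \<inter> P i)"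
      using bin(2) by (fastforce simp: V_def P_def I_def spF)
    show "{w \<in> space M. Q (Astar w) (\<sigma> w (Omega w) (Dcal w)) (Omega w) (Dcal w)} \<in> sets M"
      unfolding eq using PF MF VM by (intro sets.finite_UN finI sets.Int) (auto simp: subalgebra_def)
    have "AE w in M. real_cond_exp M F (indicator (\<Union>i\<in>I. V i \<inter> P i)) w
        = (\<Sum>i\<in>I. W (Astar w) i * indicator (P i) w)"
      by (rule real_cond_exp_finite_mixture[OF \<open>prob_space M\<close> MF finI VM disj cond PF])
    with AE_space show "AE w in M. real_cond_exp M F (indicator {w \<in> space M. Q (Astar w) (\<sigma> w (Omega w) (Dcal w)) (Omega w) (Dcal w)}) w
      = (\<Sum>i\<in>I. W (Astar w) i * of_bool (Q (Astar w) (\<sigma> w (fst i) (snd i)) (fst i) (snd i)))"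
      unfolding eq by eventually_elim (auto simp: P_def spF indicator_def intro!: sum.cong)
  qed
  have total: "AE w in M. (\<Sum>i\<in>I. W (Astar w) i) = 1"
  proof -
    interpret F: finite_measure_subalgebra M F by unfold_locales (rule MF)
    have "indicator (space M) \<in> borel_measurable F"
      unfolding spF[symmetric] by (rule borel_measurable_indicator) simp
    moreover have "integrable M (indicator (space M) :: _ \<Rightarrow> real)"
      by (rule integrable_const_bound[of _ 1]) auto
    ultimately have "AE w in M. real_cond_exp M F (indicator (space M)) w = indicator (space M) w"
      by (intro F.real_cond_exp_F_meas)
    moreover have "AE w in M. real_cond_exp M F (indicator (space M)) w = (\<Sum>i\<in>I. W (Astar w) i)"
      using mixture[of "\<lambda>_ _ _ _. True"] by simp
    ultimately show ?thesis using AE_space by eventually_elim simp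
  qed
  \<comment> \<open>Ties have probability zero, so conditionally none occurs in a configuration of positive weight.\<close>
  have ties: "AE w in M. \<forall>i\<in>I. W (Astar w) i \<noteq> 0 \<longrightarrow> no_ties (\<sigma> w (fst i) (snd i))"
  proof -
    interpret F: finite_measure_subalgebra M F by unfold_locales (rule MF)
    let ?E = "{w \<in> space M. \<not> no_ties (\<sigma> w (Omega w) (Dcal w))}"
    have mix: "AE w in M. real_cond_exp M F (indicator ?E) w
        = (\<Sum>i\<in>I. W (Astar w) i * of_bool (\<not> no_ties (\<sigma> w (fst i) (snd i))))"
      and meas_E: "?E \<in> sets M"
      using mixture[of "\<lambda>_ s _ _. \<not> no_ties s"] event[of "\<lambda>_ s _ _. \<not> no_ties s"] no_ties_cong by blast+
    have "AE w in M. indicator ?E w = (0 :: real)"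
      using \<open>AE w in M. no_ties (S w)\<close> by eventually_elim (simp add: S_def \<sigma>_def)
    then have "AE w in M. real_cond_exp M F (indicator ?E) w = real_cond_exp M F (\<lambda>_. 0) w"
      using meas_E by (intro F.real_cond_exp_cong) auto
    moreover have "AE w in M. real_cond_exp M F (\<lambda>_. 0) w = 0"
      by (rule F.real_cond_exp_F_meas) auto
    ultimately show ?thesis using mix
    proof eventually_elim
      case (elim w)
      then have "(\<Sum>i\<in>I. W (Astar w) i * of_bool (\<not> no_ties (\<sigma> w (fst i) (snd i)))) = 0" by simp
      moreover have "W (Astar w) i * of_bool (\<not> no_ties (\<sigma> w (fst i) (snd i))) \<ge> 0" for i
        unfolding W_def case_prod_beta
        by (intro mult_nonneg_nonneg sampling_weight_nonneg cal_weight_nonneg) simp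
      ultimately have "\<forall>i\<in>I. W (Astar w) i * of_bool (\<not> no_ties (\<sigma> w (fst i) (snd i))) = 0"
        by (subst (asm) sum_nonneg_eq_0_iff[OF finI]) auto
      then show ?case by auto
    qed
  qed
  have "AE w in M. real_cond_exp M F (indicator {w \<in> space M. FDP_controlled ell \<delta> (Astar w) (\<sigma> w (Omega w) (Dcal w)) (Omega w) (Dcal w)}) w
      = (\<Sum>i\<in>I. W (Astar w) i * of_bool (FDP_controlled ell \<delta> (Astar w) (\<sigma> w (fst i) (snd i)) (fst i) (snd i)))"
    by (rule mixture) (rule FDP_controlled_cong)
  with total ties AE_space
  have "AE w in M. 1 - \<delta> \<le> real_cond_exp M F (indicator {w \<in> space M. FDP_controlled ell \<delta> (Astar w) (\<sigma> w (Omega w) (Dcal w)) (Omega w) (Dcal w)}) w"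
  proof eventually_elim
    case (elim w)
    have "(1 - \<delta>) * (\<Sum>i\<in>I. W (Astar w) i) \<le>
        (\<Sum>i\<in>I. W (Astar w) i * of_bool (FDP_controlled ell \<delta> (Astar w) (\<sigma> w (fst i) (snd i)) (fst i) (snd i)))"
      unfolding I_def W_def
    proof (rule weighted_FDP_control[OF bin(1) \<open>0 < \<delta>\<close> \<open>\<delta> < 1\<close>])
      show "w \<in> space M" by fact
      show "\<sigma> w \<omega> C = \<sigma> w \<omega>' C'"
        if "binary_matrix \<omega>" "binary_matrix \<omega>'" "C \<subseteq> D0 (Astar w) \<omega>" "C' \<subseteq> D0 (Astar w) \<omega>'"
          "D1 (Astar w) \<omega> = D1 (Astar w) \<omega>'" "H0 (Astar w) \<omega> \<union> C = H0 (Astar w) \<omega>' \<union> C'" for \<omega> \<omega>' C C'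
        unfolding \<sigma>_def by (rule arg_cong[OF Z_train_cong[OF bin(1)[OF \<open>w \<in> space M\<close>] that]])
      show "no_ties (\<sigma> w \<omega> C)"
        if "binary_matrix \<omega>" "sampling_weight w0 w1 (Astar w) \<omega> * cal_weight ell (Astar w) \<omega> C \<noteq> 0" for \<omega> C
        using elim(2) that by (auto simp: I_def W_def)
    qed
    then show ?case using elim by simp
  qed
  moreover have "{w' \<in> space M. \<forall>t\<in>{0..1}. FDP (H0 (Astar w') (Omega w')) (R w' t)
             \<le> real (m w') / real (max 1 (card (R w' t))) * (t + lambda_bound (m w') (L w') \<delta>)}
      = {w \<in> space M. FDP_controlled ell \<delta> (Astar w) (\<sigma> w (Omega w) (Dcal w)) (Omega w) (Dcal w)}"
    by (simp add: FDP_controlled_def R_def L_def m_def S_def k0_def \<sigma>_def cal_size_def)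
  ultimately show "AE w in M.
      1 - \<delta> \<le> cond_prob_given M (\<lambda>w. (Astar w, X w))
        {w' \<in> space M. \<forall>t\<in>{0..1}.
           FDP (H0 (Astar w') (Omega w')) (R w' t)
             \<le> real (m w') / real (max 1 (card (R w' t))) * (t + lambda_bound (m w') (L w') \<delta>)} w"
    unfolding cond_prob_given_def F_def[symmetric] by simp
qed

end
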